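(* Let $h,f,t_0,g$ be as in the context, suppose $f$ has generalized exponential growth of type $(q,p)$, and let $\{(\lambda_n,\mu_n,u_n)\}$ be a sequence of solutions (as defined in the context) such that $\mu_n\to\infty$ as $n\to\infty$. Then, up to a subsequence, with $(r_{k,n}),(\gamma_{k,n}),(\rho_{k,n}),(\bar\rho_{k,n})$ ($k\in\mathbb N$) the concentration sequences described in the context, the following hold. (i) Suppose $1\le q<2$ and $k\in\mathbb N$. Take any sequence $(r_n)$ with $r_n\in[\bar\rho_{k,n},\rho_{k,n}]$, $r_n>0$, and put $R_n=r_n/\gamma_{k,n}$. Then $$g(u_n(r_n))+\log g'(u_n(r_n))=2\log\frac{1}{\sqrt{\lambda_n}\,r_n}+\log\frac{2a_k^2b_kR_n^{a_k}}{h(0)(1+b_kR_n^{a_k})^2}+o(1)$$ as $n\to\infty$. Moreover, assuming in addition $g(\mu_n)^{-1}\log R_n\to0$ as $n\to\infty$ if $k=1$, and assuming in addition $\inf_{t>0}f(t)/t>0$ if $q=1$, we have $$g(u_n(r_n))=(2+o(1))\log\frac1{r_n}\quad\text{as } n\to\infty .$$ (ii) Suppose $1<q<2$ and $k\in\mathbb N$. For any sequence $(r_n)$ with $r_n\in[\rho_{k,n},\bar\rho_{k+1,n}]$ and any $\delta\in[\delta_{k+1},\delta_k]$ such that $u_n(r_n)/\mu_n\to\delta$, $$g(u_n(r_n))=(\alpha_{q,k}(\delta)+o(1))\log\frac1{\sqrt{\lambda_n}\,r_n}=(\alpha_{q,k}(\delta)+o(1))\log\frac1{r_n}$$ as $n\to\infty$,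 where $\alpha_{q,k}:[\delta_{k+1},\delta_k]\to(0,2]$ is defined by $$\alpha_{q,k}(x)=\frac{2(x/\delta_k)^p}{1-\frac{2p}{2+a_k}(1-x/\delta_k)} .$$ (iii) Suppose $q=1$ and $k\in\mathbb N$. For any sequence $(r_n)$ with $r_n\in[\rho_{k,n},\bar\rho_{k+1,n}]$ and any $\eta\in[\eta_{k+1},\eta_k]$ such that $$u_n(r_n)=\mu_n-\Big(\log\frac1\eta+o(1)\Big)\frac{g(\mu_n)}{g'(\mu_n)}\quad\text{as }n\to\infty,$$ we have $$g(u_n(r_n))=(\alpha_{1,k}(\eta)+o(1))\log\frac1{\sqrt{\lambda_n}\,r_n}\quad\text{as }n\to\infty,$$ where $\alpha_{1,k}:[\eta_{k+1},\eta_k]\to(0,2]$ is defined by $$\alpha_{1,k}(x)=\frac{2(x/\eta_k)}{1-\frac{2}{2+a_k}\log(\eta_k/x)} .$$ If additionally $\inf_{t>0}f(t)/t>0$, then $$g(u_n(r_n))=(\alpha_{1,k}(\eta)+o(1))\log\frac1{r_n}\quad\text{as }n\to\infty.$$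
   Context: **Nonlinearity.** Put $\exp_1(t)=e^t$ and $\exp_k(t)=\exp(\exp_{k-1}(t))$ for $k\ge2$, $t\ge 0$. Throughout, $h:[0,1]\to(0,\infty)$ and $f:[0,\infty)\to[0,\infty)$ are continuously differentiable, $t_0\ge0$ is such that $f(t)>0$ for all $t\ge t_0$ and $f\in C^2([t_0,\infty))$, and $g(t)=\log f(t)$ for $t\ge t_0$. We say that $f$ has generalized exponential growth of type $(q,p)$, where $(q,p)\in\{1\}\times(0,\infty]\,\cup\,(1,\infty)\times(0,\infty)$, if (a) $g'(t)>0$, $g''(t)>0$ for all $t\ge t_0$, $\lim_{t\to\infty}\frac{g'(t)^2}{g(t)g''(t)}=q$ and $\lim_{t\to\infty}\frac{tg'(t)}{g(t)}=p$; (b) if $q=1$: $tg'(t)/g(t)$ is nondecreasing for $t\ge t_0$, and there exist $m\in\mathbb N$ and $\hat g\in C^2([t_0,\infty))$ such that $f(t)=\exp_m(\hat g(t))$ and $\hat g'(t)/\hat g(t)$ is nonincreasing for all $t\ge t_0$. It is known that then $1/p+1/q=1$ (with $1/\infty=0$); so $q\in[1,2)$ means $p\in(2,\infty]$, with $p=\infty$ iff $q=1$. **Sequence of solutions.** $(\lambda_n,\mu_n,u_n)\in(0,\infty)\times(0,\infty)\times C^2([0,1])$ with, for all $n\in\mathbb N$, $$-u_n''-\tfrac1r u_n'=\lambda_n h f(u_n),\ u_n>0\ \text{in }(0,1),\qquad u_n(0)=\mu_n,\ u_n'(0)=0=u_n(1).$$ **Constants.** Let $q\in[1,2)$, $1/p+1/q=1$.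 Set $a_1=2,\delta_1=1,\eta_1=1$. If $q>1$, define $(a_k)\subset(0,2]$, $(\delta_k)\subset(0,1]$ inductively by $$\tfrac{2p}{2+a_k}\Big(1-\tfrac{\delta_{k+1}}{\delta_k}\Big)-1+\Big(\tfrac{\delta_{k+1}}{\delta_k}\Big)^p=0,\ \ \delta_{k+1}<\delta_k,\qquad a_{k+1}=2-\Big(\tfrac{\delta_{k+1}}{\delta_k}\Big)^{p-1}(2+a_k),$$ and $\eta_k=\delta_k^p$. If $q=1$, define $(a_k),(\eta_k)\subset(0,2]$ inductively by $$\tfrac{2}{2+a_k}\log\tfrac{\eta_k}{\eta_{k+1}}-1+\tfrac{\eta_{k+1}}{\eta_k}=0,\ \ \eta_{k+1}<\eta_k,\qquad a_{k+1}=2-\tfrac{\eta_{k+1}}{\eta_k}(2+a_k),$$ and $\delta_k=1$ for all $k$. Put $b_k=(\sqrt2/a_k)^{a_k}$ and $z_k(r)=\log\frac{2a_k^2b_k}{r^{2-a_k}(1+b_kr^{a_k})^2}$ (for $r\ge0$ if $k=1$, $r>0$ if $k>1$). **Concentration sequences.** Let $q\in[1,2)$ and $\mu_n\to\infty$. It is known from earlier work that, after passing to a subsequence, for every $k\in\mathbb N$ there are sequences $(r_{k,n})\subset(0,1)$, $\gamma_{k,n}>0$ and $(\rho_{k,n}),(\bar\rho_{k,n})\subset[0,1)$, with $\bar\rho_{1,n}=0$ for all $n$, such that as $n\to\infty$: (1) $u_n(s_n)/\mu_n\to\delta_k$ for $(s_n)=(r_{k,n}),(\rho_{k,n}),(\bar\rho_{k,n})$,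 and if $q=1$, moreover $u_n(s_n)=\mu_n-(\log\frac1{\eta_k}+o(1))\frac{g(\mu_n)}{g'(\mu_n)}$ for these three sequences; (2) $\lambda_nr_{k,n}^2h(r_{k,n})f'(u_n(r_{k,n}))\to a_k^2/2$; (3) $\lambda_nh(r_{k,n})f'(u_n(r_{k,n}))\gamma_{k,n}^2=1$ for large $n$, and $\gamma_{k,n}\to0$; (4) $\rho_{k,n}\to0$, $\bar\rho_{k,n}/\gamma_{k,n}\to0$, $\rho_{k,n}/\gamma_{k,n}\to\infty$; (5) $z_{k,n}(r):=g'(u_n(r_{k,n}))(u_n(\gamma_{k,n}r)-u_n(r_{k,n}))$, $r\in[0,1/\gamma_{k,n}]$, satisfies $\|z_{k,n}-z_k\|_{C^2_{\mathrm{loc}}([\bar\rho_{k,n}/\gamma_{k,n},\rho_{k,n}/\gamma_{k,n}])}\to0$ (in particular $C^2$ convergence on compact subsets of $(0,\infty)$, and of $[0,\infty)$ if $k=1$); (6) $g'(u_n(r_{k,n}))\int_{\bar\rho_{k,n}}^{\rho_{k,n}}\lambda_nhf(u_n)r\,dr\to2a_k$, $\int_{\bar\rho_{k,n}}^{\rho_{k,n}}\lambda_nhf'(u_n)r\,dr\to2a_k$, and $g'(\mu_n)\int_{\rho_{k,n}}^{\bar\rho_{k+1,n}}\lambda_nhf(u_n)r\,dr\to0$; (7) if $q>1$, or if $q=1$ and $\inf_{t>0}f(t)/t>0$: $\frac{\log(1/\lambda_n)}{g(\mu_n)}\to0$ and $\frac{\log(1/r_{k,n})}{g(\mu_n)}\to\frac{\eta_k}2$;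 (8) $\frac{\log(\rho_{k,n}/\gamma_{k,n})}{g(u_n(r_{k,n}))}\to0$, $\frac{\log(\bar\rho_{k,n}/\gamma_{k,n})}{g(u_n(r_{k,n}))}\to0$ (the latter for $k\ne1$), and $$\sup_{r\in[\bar\rho_{k,n}/\gamma_{k,n},\,\rho_{k,n}/\gamma_{k,n}]}\left|\frac{(\gamma_{k,n}r)^2\lambda_nh(\gamma_{k,n}r)f'(u_n(\gamma_{k,n}r))}{r^2e^{z_k(r)}}-1\right|\to0 .$$ Such sequences (along such a subsequence) are fixed. *)

theory Defs
  imports "HOL-Analysis.Analysis"
begin

section \<open>Functions of class C1 and C2 on an interval\<close>

text \<open>
  Derivatives are taken relative to the interval on which the function lives, so they are one-sided
  at an endpoint that belongs to the interval.
\<close>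

definition deriv_on :: "real set \<Rightarrow> (real \<Rightarrow> real) \<Rightarrow> real \<Rightarrow> real" where
  "deriv_on S f x = vector_derivative f (at x within S)"

definition C1_on :: "real set \<Rightarrow> (real \<Rightarrow> real) \<Rightarrow> bool" where
  "C1_on S f \<longleftrightarrow> f differentiable_on S \<and> continuous_on S (deriv_on S f)"

definition C2_on :: "real set \<Rightarrow> (real \<Rightarrow> real) \<Rightarrow> bool" where
  "C2_on S f \<longleftrightarrow> C1_on S f \<and> C1_on S (deriv_on S f)"


section \<open>Asymptotic notation\<close>

text \<open>\<open>X\<^sub>n = (c + o(1)) Y\<^sub>n\<close> as \<open>n \<rightarrow> \<infinity>\<close>.\<close>

definition eq_coeff :: "(nat \<Rightarrow> real) \<Rightarrow> real \<Rightarrow> (nat \<Rightarrow> real) \<Rightarrow> bool" where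
  "eq_coeff X c Y \<longleftrightarrow>
     (\<exists>\<epsilon>. \<epsilon> \<longlonglongrightarrow> 0 \<and> (\<forall>\<^sub>F n in sequentially. X n = (c + \<epsilon> n) * Y n))"

text \<open>The supremum of \<open>\<bar>F\<^sub>n\<bar>\<close> over the \<open>n\<close>-dependent set \<open>A\<^sub>n\<close> tends to \<open>0\<close>.\<close>

definition sup_vanishes :: "(nat \<Rightarrow> real set) \<Rightarrow> (nat \<Rightarrow> real \<Rightarrow> real) \<Rightarrow> bool" where
  "sup_vanishes A F \<longleftrightarrow>
     (\<forall>e>0. \<forall>\<^sub>F n in sequentially. \<forall>r\<in>A n. \<bar>F n r\<bar> \<le> e)"


section \<open>The nonlinearity\<close>

definition nonlinearity :: "(real \<Rightarrow> real) \<Rightarrow> (real \<Rightarrow> real) \<Rightarrow> real \<Rightarrow> bool" where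
  "nonlinearity h f t0 \<longleftrightarrow>
     C1_on {0..1} h \<and> (\<forall>x\<in>{0..1}. h x > 0) \<and>
     C1_on {0..} f \<and> (\<forall>t\<in>{0..}. f t \<ge> 0) \<and>
     t0 \<ge> 0 \<and> (\<forall>t\<in>{t0..}. f t > 0) \<and> C2_on {t0..} f"

definition log_f :: "(real \<Rightarrow> real) \<Rightarrow> real \<Rightarrow> real" where
  "log_f f t = ln (f t)"

text \<open>
  The growth condition. The exponent \<open>p\<close> may be \<open>\<infinity>\<close> if \<open>q = 1\<close>. Since the \<open>m\<close>-fold exponential
  is considered on nonnegative arguments and the quotient \<open>\<^term>\<open>ghat' / ghat\<close>\<close> has to make sense,
  \<open>\<^term>\<open>ghat\<close>\<close> is positive.
\<close>

definition gen_exp_growth :: "(real \<Rightarrow> real) \<Rightarrow> real \<Rightarrow> real \<Rightarrow> ereal \<Rightarrow> bool" where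
  "gen_exp_growth f t0 q p \<longleftrightarrow>
     (let g = log_f f; g' = deriv_on {t0..} g; g'' = deriv_on {t0..} g' in
       ((q = 1 \<and> 0 < p) \<or> (1 < q \<and> 0 < p \<and> p < \<infinity>)) \<and>
       (\<forall>t\<in>{t0..}. g' t > 0 \<and> g'' t > 0) \<and>
       ((\<lambda>t. (g' t)\<^sup>2 / (g t * g'' t)) \<longlongrightarrow> q) at_top \<and>
       ((\<lambda>t. ereal (t * g' t / g t)) \<longlongrightarrow> p) at_top \<and>
       (q = 1 \<longrightarrow>
          mono_on {t0..} (\<lambda>t. t * g' t / g t) \<and>
          (\<exists>m ghat. m \<ge> 1 \<and> C2_on {t0..} ghat \<and> (\<forall>t\<in>{t0..}. ghat t > 0) \<and>
             (\<forall>t\<in>{t0..}. f t = (exp ^^ m) (ghat t)) \<and>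
             antimono_on {t0..} (\<lambda>t. deriv_on {t0..} ghat t / ghat t))))"

definition inf_quot_pos :: "(real \<Rightarrow> real) \<Rightarrow> bool" where
  "inf_quot_pos f \<longleftrightarrow> (INF t\<in>{0<..}. f t / t) > 0"


section \<open>Sequences of solutions\<close>

definition solution_seq ::
  "(real \<Rightarrow> real) \<Rightarrow> (real \<Rightarrow> real) \<Rightarrow> (nat \<Rightarrow> real) \<Rightarrow> (nat \<Rightarrow> real) \<Rightarrow> (nat \<Rightarrow> real \<Rightarrow> real) \<Rightarrow> bool" where
  "solution_seq h f lam mu u \<longleftrightarrow>
     (\<forall>n. let u' = deriv_on {0..1} (u n); u'' = deriv_on {0..1} u' in
        lam n > 0 \<and> mu n > 0 \<and> C2_on {0..1} (u n) \<and>
        (\<forall>r\<in>{0<..<1}. - u'' r - 1 / r * u' r = lam n * h r * f (u n r) \<and> u n r > 0) \<and>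
        u n 0 = mu n \<and> u' 0 = 0 \<and> u n 1 = 0)"


section \<open>The constants\<close>

text \<open>
  All sequences are indexed by \<open>k \<ge> 1\<close>; the value at \<open>k = 0\<close> is irrelevant. First the case \<open>q > 1\<close>.
\<close>

fun a_super :: "real \<Rightarrow> nat \<Rightarrow> real" and d_super :: "real \<Rightarrow> nat \<Rightarrow> real" where
  "a_super p 0 = 2"
| "a_super p (Suc 0) = 2"
| "a_super p (Suc (Suc k)) =
     2 - (d_super p (Suc (Suc k)) / d_super p (Suc k)) powr (p - 1) * (2 + a_super p (Suc k))"
| "d_super p 0 = 1"
| "d_super p (Suc 0) = 1"
| "d_super p (Suc (Suc k)) =
     (THE x. 0 < x \<and> x < d_super p (Suc k) \<and>
        2 * p / (2 + a_super p (Suc k)) * (1 - x / d_super p (Suc k)) - 1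
          + (x / d_super p (Suc k)) powr p = 0)"

text \<open>The case \<open>q = 1\<close>.\<close>

fun a_crit :: "nat \<Rightarrow> real" and e_crit :: "nat \<Rightarrow> real" where
  "a_crit 0 = 2"
| "a_crit (Suc 0) = 2"
| "a_crit (Suc (Suc k)) =
     2 - e_crit (Suc (Suc k)) / e_crit (Suc k) * (2 + a_crit (Suc k))"
| "e_crit 0 = 1"
| "e_crit (Suc 0) = 1"
| "e_crit (Suc (Suc k)) =
     (THE x. 0 < x \<and> x < e_crit (Suc k) \<and>
        2 / (2 + a_crit (Suc k)) * ln (e_crit (Suc k) / x) - 1 + x / e_crit (Suc k) = 0)"

definition a_seq :: "real \<Rightarrow> real \<Rightarrow> nat \<Rightarrow> real" where
  "a_seq q p k = (if q = 1 then a_crit k else a_super p k)"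

definition delta_seq :: "real \<Rightarrow> real \<Rightarrow> nat \<Rightarrow> real" where
  "delta_seq q p k = (if q = 1 then 1 else d_super p k)"

definition eta_seq :: "real \<Rightarrow> real \<Rightarrow> nat \<Rightarrow> real" where
  "eta_seq q p k = (if q = 1 then e_crit k else d_super p k powr p)"

definition b_seq :: "real \<Rightarrow> real \<Rightarrow> nat \<Rightarrow> real" where
  "b_seq q p k = (sqrt 2 / a_seq q p k) powr (a_seq q p k)"

text \<open>
  For \<open>k = 1\<close> we have \<open>2 - a\<^sub>k = 0\<close>, and \<open>r\<^sup>0 = 1\<close> also at \<open>r = 0\<close>, whereas \<open>\<^term>\<open>0 powr 0 = (0::real)\<close>\<close>.
\<close>

definition limit_profile :: "real \<Rightarrow> real \<Rightarrow> nat \<Rightarrow> real \<Rightarrow> real" where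
  "limit_profile q p k r =
     (let a = a_seq q p k; b = b_seq q p k in
       ln (2 * a\<^sup>2 * b /
         ((if a = 2 then 1 else r powr (2 - a)) * (1 + b * r powr a)\<^sup>2)))"


section \<open>Concentration sequences\<close>

text \<open>
  Local C2 convergence on the \<open>n\<close>-dependent sets \<open>A\<^sub>n \<subseteq> D\<^sub>n\<close> to a profile on \<open>D\<close>: uniform convergence
  up to second derivatives on \<open>A\<^sub>n \<inter> K\<close> for every compact \<open>K \<subseteq> D\<close>. The functions \<open>w\<^sub>n\<close> live on \<open>D\<^sub>n\<close>.
\<close>

definition C2_loc_conv ::
  "real set \<Rightarrow> (nat \<Rightarrow> real set) \<Rightarrow> (nat \<Rightarrow> real set) \<Rightarrow> (nat \<Rightarrow> real \<Rightarrow> real) \<Rightarrow> (real \<Rightarrow> real) \<Rightarrow> bool" where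
  "C2_loc_conv D Dn A w z \<longleftrightarrow>
     (\<forall>K. compact K \<and> K \<subseteq> D \<longrightarrow>
        sup_vanishes (\<lambda>n. A n \<inter> K) (\<lambda>n r. w n r - z r) \<and>
        sup_vanishes (\<lambda>n. A n \<inter> K) (\<lambda>n r. deriv_on (Dn n) (w n) r - deriv_on D z r) \<and>
        sup_vanishes (\<lambda>n. A n \<inter> K)
          (\<lambda>n r. deriv_on (Dn n) (deriv_on (Dn n) (w n)) r - deriv_on D (deriv_on D z) r))"

text \<open>
  The argument \<open>s\<close> is an \<open>n\<close>-indexed sequence of radii at the \<open>k\<close>-th concentration level.
\<close>

definition at_level ::
  "(real \<Rightarrow> real) \<Rightarrow> real \<Rightarrow> real \<Rightarrow> real \<Rightarrow> (nat \<Rightarrow> real) \<Rightarrow> (nat \<Rightarrow> real \<Rightarrow> real) \<Rightarrow> nat \<Rightarrow> (nat \<Rightarrow> real) \<Rightarrow> bool" where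
  "at_level f t0 q p mu u k s \<longleftrightarrow>
     (let g = log_f f; g' = deriv_on {t0..} g in
       (\<lambda>n. u n (s n) / mu n) \<longlonglongrightarrow> delta_seq q p k \<and>
       (q = 1 \<longrightarrow>
          eq_coeff (\<lambda>n. mu n - u n (s n)) (ln (1 / eta_seq q p k)) (\<lambda>n. g (mu n) / g' (mu n))))"

text \<open>
  The sequences are written \<open>r k n\<close>, \<open>\<gamma> k n\<close>, \<open>\<rho> k n\<close>, \<open>\<sigma> k n\<close>, with \<open>k \<ge> 1\<close> the number of the
  concentration; \<open>\<sigma>\<close> is the lower endpoint, usually denoted by a barred \<open>\<rho>\<close>. In the last supremum, \<open>r = 0\<close>
  is left out: it only occurs for \<open>k = 1\<close> (and large \<open>n\<close>), where the factor \<open>r\<^sup>2\<close> cancels and the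
  supremum is unchanged by continuity, whereas the quotient as written would be \<open>0 / 0 = 0\<close>.
\<close>

definition concentration_seqs ::
  "(real \<Rightarrow> real) \<Rightarrow> (real \<Rightarrow> real) \<Rightarrow> real \<Rightarrow> real \<Rightarrow> real \<Rightarrow>
   (nat \<Rightarrow> real) \<Rightarrow> (nat \<Rightarrow> real) \<Rightarrow> (nat \<Rightarrow> real \<Rightarrow> real) \<Rightarrow>
   (nat \<Rightarrow> nat \<Rightarrow> real) \<Rightarrow> (nat \<Rightarrow> nat \<Rightarrow> real) \<Rightarrow> (nat \<Rightarrow> nat \<Rightarrow> real) \<Rightarrow> (nat \<Rightarrow> nat \<Rightarrow> real) \<Rightarrow> bool" where
  "concentration_seqs h f t0 q p lam mu u r \<gamma> \<rho> \<sigma> \<longleftrightarrow>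
     (let f' = deriv_on {0..} f; g = log_f f; g' = deriv_on {t0..} g in
      (\<forall>n. \<sigma> 1 n = 0) \<and>
      (\<forall>k\<ge>1. let a = a_seq q p k; z = limit_profile q p k in
        (\<forall>n. r k n \<in> {0<..<1} \<and> \<gamma> k n > 0 \<and> \<rho> k n \<in> {0..<1} \<and> \<sigma> k n \<in> {0..<1}) \<and>
        (\<forall>s\<in>{r k, \<rho> k, \<sigma> k}. at_level f t0 q p mu u k s) \<and>
        (\<lambda>n. lam n * (r k n)\<^sup>2 * h (r k n) * f' (u n (r k n))) \<longlonglongrightarrow> a\<^sup>2 / 2 \<and>
        (\<forall>\<^sub>F n in sequentially. lam n * h (r k n) * f' (u n (r k n)) * (\<gamma> k n)\<^sup>2 = 1) \<and>
        \<gamma> k \<longlonglongrightarrow> 0 \<and>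
        \<rho> k \<longlonglongrightarrow> 0 \<and> (\<lambda>n. \<sigma> k n / \<gamma> k n) \<longlonglongrightarrow> 0 \<and>
        filterlim (\<lambda>n. \<rho> k n / \<gamma> k n) at_top sequentially \<and>
        C2_loc_conv (if k = 1 then {0..} else {0<..})
          (\<lambda>n. {0..1 / \<gamma> k n}) (\<lambda>n. {\<sigma> k n / \<gamma> k n..\<rho> k n / \<gamma> k n})
          (\<lambda>n x. g' (u n (r k n)) * (u n (\<gamma> k n * x) - u n (r k n))) z \<and>
        (\<lambda>n. g' (u n (r k n)) * integral {\<sigma> k n..\<rho> k n} (\<lambda>x. lam n * h x * f (u n x) * x))
          \<longlonglongrightarrow> 2 * a \<and>
        (\<lambda>n. integral {\<sigma> k n..\<rho> k n} (\<lambda>x. lam n * h x * f' (u n x) * x)) \<longlonglongrightarrow> 2 * a \<and>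
        (\<lambda>n. g' (mu n) * integral {\<rho> k n..\<sigma> (Suc k) n} (\<lambda>x. lam n * h x * f (u n x) * x))
          \<longlonglongrightarrow> 0 \<and>
        (q > 1 \<or> (q = 1 \<and> inf_quot_pos f) \<longrightarrow>
           (\<lambda>n. ln (1 / lam n) / g (mu n)) \<longlonglongrightarrow> 0 \<and>
           (\<lambda>n. ln (1 / r k n) / g (mu n)) \<longlonglongrightarrow> eta_seq q p k / 2) \<and>
        (\<lambda>n. ln (\<rho> k n / \<gamma> k n) / g (u n (r k n))) \<longlonglongrightarrow> 0 \<and>
        (k \<noteq> 1 \<longrightarrow> (\<lambda>n. ln (\<sigma> k n / \<gamma> k n) / g (u n (r k n))) \<longlonglongrightarrow> 0) \<and>
        sup_vanishes (\<lambda>n. {\<sigma> k n / \<gamma> k n..\<rho> k n / \<gamma> k n} \<inter> {0<..})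
          (\<lambda>n x. (\<gamma> k n * x)\<^sup>2 * lam n * h (\<gamma> k n * x) * f' (u n (\<gamma> k n * x))
                   / (x\<^sup>2 * exp (z x)) - 1)))"


section \<open>The limit coefficients\<close>

definition alpha_super :: "real \<Rightarrow> nat \<Rightarrow> real \<Rightarrow> real" where
  "alpha_super p k x =
     2 * (x / d_super p k) powr p / (1 - 2 * p / (2 + a_super p k) * (1 - x / d_super p k))"

definition alpha_crit :: "nat \<Rightarrow> real \<Rightarrow> real" where
  "alpha_crit k x =
     2 * (x / e_crit k) / (1 - 2 / (2 + a_crit k) * ln (e_crit k / x))"

end

theory Submission
  imports Defs
begin

text \<open>
  Taking logarithms in the uniform convergence of \<open>r\<^sup>2 \<lambda>\<^sub>n h f'(u\<^sub>n)\<close> gives (i); since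
  \<open>log g'(u\<^sub>n) = o(g(u\<^sub>n))\<close>, at \<open>r = \<rho>\<^bsub>k,n\<^esub>\<close> it yields \<open>log (1 / (\<surd>\<lambda>\<^sub>n \<rho>\<^bsub>k,n\<^esub>)) / g(\<mu>\<^sub>n) \<rightarrow> \<eta>\<^sub>k / 2\<close>.
  On \<open>[\<rho>\<^bsub>k,n\<^esub>, \<sigma>\<^bsub>k+1,n\<^esub>]\<close> the flux \<open>V\<^sub>n(r) = - r u\<^sub>n'(r)\<close>, which is nondecreasing, is the mass of the first
  \<open>k\<close> concentrations up to \<open>o(1 / g'(\<mu>\<^sub>n))\<close>; the recursion for \<open>a\<^sub>k\<close> makes this sum telescope to
  \<open>(2 + a\<^sub>k) / G\<^sub>k\<close> with \<open>G\<^sub>k = lim g'(u\<^sub>n(r\<^bsub>k,n\<^esub>)) / g'(\<mu>\<^sub>n)\<close>. So \<open>u\<^sub>n\<close> is asymptotically affine in \<open>log r\<close> there,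
  and comparing \<open>log (1 / r\<^sub>n)\<close> with \<open>log (1 / \<rho>\<^bsub>k,n\<^esub>)\<close> gives (ii) and (iii). The limits of \<open>g(u\<^sub>n) / g(\<mu>\<^sub>n)\<close> and
  \<open>g'(u\<^sub>n) / g'(\<mu>\<^sub>n)\<close> come from \<open>w = g / g'\<close>, which satisfies \<open>w' \<rightarrow> 1 - 1 / q\<close>.
\<close>

section \<open>The constants\<close>

text \<open>\<open>F\<close> is strictly convex with positive slope at its zero 1, so it is negative
  just to the left of 1; positivity at \<open>y0\<close> forces a second zero \<open>y\<close>. The
  sign of \<open>F' y\<close> will keep the next \<open>a\<close> positive, the sign of
  \<open>F\<close> on \<open>{y..1}\<close> will bound \<open>alpha_super\<close> and
  \<open>alpha_crit\<close>.\<close>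

lemma convex_second_root:
  fixes F F' :: "real \<Rightarrow> real"
  assumes deriv: "\<And>x. 0 < x \<Longrightarrow> (F has_real_derivative F' x) (at x)"
    and mono: "\<And>x y. 0 < x \<Longrightarrow> x < y \<Longrightarrow> F' x < F' y"
    and "F 1 = 0" "F' 1 > 0" and y0: "0 < y0" "y0 < 1" "F y0 > 0"
  shows "\<exists>y. 0 < y \<and> y < 1 \<and> F y = 0 \<and> F' y < 0 \<and>
    (\<forall>x. 0 < x \<and> x < 1 \<and> F x = 0 \<longrightarrow> x = y) \<and> (\<forall>x\<in>{y..1}. F x \<le> 0)"
proof -
  \<comment> \<open>A nonnegative value between two zeros would give \<open>F' s \<ge> 0\<close> to
    the left of \<open>F' t \<le> 0\<close>, against strict monotonicity of
    \<open>F'\<close>.\<close>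
  have neg: "F x < 0" if xy: "0 < y" "y < x" "x < 1" "F y = 0" for x y
  proof (rule ccontr)
    assume "\<not> F x < 0"
    have "\<exists>s>y. s < x \<and> F x - F y = (x - y) * F' s"
      using xy deriv by (intro MVT2) auto
    then obtain s where s: "y < s" "s < x" "F x - F y = (x - y) * F' s" by blast
    have "\<exists>t>x. t < 1 \<and> F 1 - F x = (1 - x) * F' t"
      using xy deriv by (intro MVT2) auto
    then obtain t where t: "x < t" "t < 1" "F 1 - F x = (1 - x) * F' t" by blast
    have "F' s \<ge> 0"
      using s xy \<open>\<not> F x < 0\<close> by (metis diff_gt_0_iff_gt diff_zero linorder_not_less mult_less_0_iff)
    moreover have "F' t \<le> 0"
      using t xy \<open>\<not> F x < 0\<close> \<open>F 1 = 0\<close>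
      by (metis diff_gt_0_iff_gt diff_0 linorder_not_less mult_pos_pos)
    ultimately show False
      using mono[of s t] s t xy by linarith
  qed
  obtain d where d: "d > 0" "\<And>h. 0 < h \<Longrightarrow> h < d \<Longrightarrow> F (1 - h) < F 1"
    using DERIV_pos_inc_left[OF deriv \<open>F' 1 > 0\<close>] by auto
  \<comment> \<open>Close enough to 1 for \<open>F x1 < 0\<close>, yet still to the right of
    \<open>y0\<close>, so the intermediate value theorem applies on \<open>{y0..x1}\<close>.\<close>
  define x1 where "x1 = 1 - min (d / 2) ((1 - y0) / 2)"
  have x1: "F x1 < 0" "y0 < x1" "x1 < 1"
    using d(2)[of "1 - x1"] d(1) y0 \<open>F 1 = 0\<close> by (auto simp: x1_def min_def field_simps)
  have "\<exists>y\<ge>y0. y \<le> x1 \<and> F y = 0"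
    using x1 y0 by (intro IVT2) (auto intro!: DERIV_isCont[OF deriv])
  then obtain y where y: "y0 \<le> y" "y \<le> x1" "F y = 0" by auto
  have y01: "0 < y" "y < 1" using y x1 y0 by auto
  have "\<exists>s>y. s < 1 \<and> F 1 - F y = (1 - y) * F' s"
    using y01 deriv by (intro MVT2) auto
  then obtain s where s: "y < s" "s < 1" "F 1 - F y = (1 - y) * F' s" by blast
  hence "F' s = 0" using y \<open>F 1 = 0\<close> by auto
  hence F'y: "F' y < 0" using mono[of y s] s y01 by auto
  have uniq: "x = y" if "0 < x" "x < 1" "F x = 0" for x
    using neg[of x y] neg[of y x] that y(3) y01 by (cases x y rule: linorder_cases) simp_all
  have nonpos: "F x \<le> 0" if "y \<le> x" "x \<le> 1" for x
    using neg[of y x] that y(3) y01 \<open>F 1 = 0\<close> by (cases "x = y \<or> x = 1") auto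
  show ?thesis
    by (rule exI[of _ y]) (auto intro: uniq nonpos simp: F'y y(3) y01)
qed

text \<open>With \<open>A = 2 * p / (2 + a)\<close> the ranges of \<open>a\<close> and
  \<open>p\<close> give \<open>1 < A\<close> and \<open>A < p\<close>: the convex function is
  positive near 0 and has slope \<open>p - A > 0\<close> at 1. The bound on
  \<open>y powr (p - 1)\<close> is the negative slope at the second zero.\<close>

lemma super_root:
  fixes a p :: real
  assumes "0 < a" "a \<le> 2" "p > 2"
  shows "\<exists>y. 0 < y \<and> y < 1 \<and> 2 * p / (2 + a) * (1 - y) - 1 + y powr p = 0 \<and>
    y powr (p - 1) < 2 / (2 + a) \<and>
    (\<forall>x. 0 < x \<and> x < 1 \<and> 2 * p / (2 + a) * (1 - x) - 1 + x powr p = 0 \<longrightarrow> x = y) \<and>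
    (\<forall>x\<in>{y..1}. 2 * p / (2 + a) * (1 - x) - 1 + x powr p \<le> 0)"
proof -
  define A where "A = 2 * p / (2 + a)"
  have "2 + a < 2 * p" "2 * p < p * (2 + a)" using assms by (auto simp: algebra_simps)
  hence A: "1 < A" "A < p"
    using assms by (auto simp: A_def less_divide_eq divide_less_eq)
  have Ap: "A / p = 2 / (2 + a)" using assms by (simp add: A_def)
  \<comment> \<open>Here the affine part \<open>A * (1 - y0) - 1\<close> is half of its value
    \<open>A - 1\<close> at 0, hence still positive.\<close>
  define y0 where "y0 = (A - 1) / (2 * A)"
  have "A * (1 - y0) - 1 = (A - 1) / 2"
    using A by (simp add: y0_def field_simps)
  hence "A * (1 - y0) - 1 > 0" using A by simp
  hence F0: "A * (1 - y0) - 1 + y0 powr p > 0" by (rule add_pos_nonneg) simp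
  obtain y where y: "0 < y" "y < 1" "A * (1 - y) - 1 + y powr p = 0" "p * y powr (p - 1) - A < 0"
    "\<forall>x. 0 < x \<and> x < 1 \<and> A * (1 - x) - 1 + x powr p = 0 \<longrightarrow> x = y"
    "\<forall>x\<in>{y..1}. A * (1 - x) - 1 + x powr p \<le> 0"
  proof (atomize_elim, rule convex_second_root)
    show "((\<lambda>x. A * (1 - x) - 1 + x powr p) has_real_derivative p * x powr (p - 1) - A) (at x)"
      if "0 < x" for x
      using that by (auto intro!: derivative_eq_intros)
    show "p * x powr (p - 1) - A < p * y powr (p - 1) - A" if "0 < x" "x < y" for x y
      using that assms by (auto intro!: powr_less_mono2)
    show "0 < y0" "y0 < 1" using A by (auto simp: y0_def field_simps)
  qed (use A F0 in auto)
  moreover have "y powr (p - 1) < A / p"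
    using y(4) assms by (simp add: field_simps)
  ultimately show ?thesis
    unfolding A_def[symmetric] Ap[symmetric] by (intro exI[of _ y] conjI)
qed

text \<open>The counterpart for q = 1: the slope at 1 is \<open>1 - B > 0\<close> with
  \<open>B = 2 / (2 + a)\<close>, and negative slope at the second zero reads
  \<open>y < B\<close>.\<close>

lemma crit_root:
  fixes a :: real
  assumes "0 < a"
  shows "\<exists>y. 0 < y \<and> y < 1 \<and> 2 / (2 + a) * ln (1 / y) - 1 + y = 0 \<and>
    y < 2 / (2 + a) \<and>
    (\<forall>x. 0 < x \<and> x < 1 \<and> 2 / (2 + a) * ln (1 / x) - 1 + x = 0 \<longrightarrow> x = y) \<and>
    (\<forall>x\<in>{y..1}. 2 / (2 + a) * ln (1 / x) - 1 + x \<le> 0)"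
proof -
  define B where "B = 2 / (2 + a)"
  have B: "0 < B" "B < 1"
    using assms by (auto simp: B_def field_simps)
  obtain y where y: "0 < y" "y < 1" "B * ln (1 / y) - 1 + y = 0" "1 - B / y < 0"
    "\<forall>x. 0 < x \<and> x < 1 \<and> B * ln (1 / x) - 1 + x = 0 \<longrightarrow> x = y"
    "\<forall>x\<in>{y..1}. B * ln (1 / x) - 1 + x \<le> 0"
  proof (atomize_elim, rule convex_second_root)
    show "((\<lambda>x. B * ln (1 / x) - 1 + x) has_real_derivative 1 - B / x) (at x)"
      if "0 < x" for x
      using that by (auto intro!: derivative_eq_intros simp: field_simps power2_eq_square)
    show "1 - B / x < 1 - B / y" if "0 < x" "x < y" for x y
      using that B by (auto simp: field_simps)
    \<comment> \<open>At \<open>exp (- 1 / B)\<close> the logarithmic term equals 1 and cancels the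
      constant, leaving the positive value \<open>exp (- 1 / B)\<close>.\<close>
    show "0 < exp (- 1 / B)" "exp (- 1 / B) < 1"
      using B by auto
    show "B * ln (1 / exp (- 1 / B)) - 1 + exp (- 1 / B) > 0"
      using B by (simp add: ln_div)
  qed (use B in auto)
  moreover have "y < B"
    using y(1,4) by (simp add: field_simps)
  ultimately show ?thesis
    unfolding B_def[symmetric] by (intro exI[of _ y] conjI)
qed

text \<open>Passing to the ratio \<open>y\<close> of consecutive terms removes
  \<open>d_super p k\<close> from the equation; uniqueness of its root then evaluates the definite
  description.\<close>

lemma d_super_Suc:
  assumes "k \<ge> 1" "0 < a_super p k" "a_super p k \<le> 2" "0 < d_super p k" "p > 2"
  shows "\<exists>y. 0 < y \<and> y < 1 \<and> d_super p (Suc k) = y * d_super p k \<and>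
    a_super p (Suc k) = 2 - y powr (p - 1) * (2 + a_super p k) \<and>
    y powr (p - 1) < 2 / (2 + a_super p k) \<and>
    (\<forall>x\<in>{y..1}. 2 * p / (2 + a_super p k) * (1 - x) - 1 + x powr p \<le> 0)"
proof -
  obtain j where k: "k = Suc j" using assms(1) by (cases k) auto
  define a where "a = a_super p k"
  define d where "d = d_super p k"
  have d: "d > 0" and a: "0 < a" "a \<le> 2" using assms by (auto simp: a_def d_def)
  obtain y where y: "0 < y" "y < 1" "2 * p / (2 + a) * (1 - y) - 1 + y powr p = 0"
    "y powr (p - 1) < 2 / (2 + a)"
    "\<forall>x. 0 < x \<and> x < 1 \<and> 2 * p / (2 + a) * (1 - x) - 1 + x powr p = 0 \<longrightarrow> x = y"
    "\<forall>x\<in>{y..1}. 2 * p / (2 + a) * (1 - x) - 1 + x powr p \<le> 0"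
    using super_root[OF a assms(5)] by (elim exE conjE) (rule that)
  have "d_super p (Suc k) = (THE x. 0 < x \<and> x < d \<and>
      2 * p / (2 + a) * (1 - x / d) - 1 + (x / d) powr p = 0)"
    by (simp add: k a_def d_def)
  also have "\<dots> = y * d"
  proof (rule the_equality)
    show "0 < y * d \<and> y * d < d \<and> 2 * p / (2 + a) * (1 - y * d / d) - 1 + (y * d / d) powr p = 0"
      using y(1-3) d by auto
    show "x = y * d"
      if "0 < x \<and> x < d \<and> 2 * p / (2 + a) * (1 - x / d) - 1 + (x / d) powr p = 0" for x
      using y(5)[rule_format, of "x / d"] that d by (auto simp: field_simps)
  qed
  finally have dS: "d_super p (Suc k) = y * d" .
  moreover have "a_super p (Suc k) = 2 - (d_super p (Suc k) / d) powr (p - 1) * (2 + a)"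
    unfolding k a_def d_def by (simp only: a_super.simps)
  ultimately have "d_super p (Suc k) = y * d" "a_super p (Suc k) = 2 - y powr (p - 1) * (2 + a)"
    using d by simp_all
  thus ?thesis
    using y(1,2,4,6) unfolding a_def d_def by (intro exI[of _ y] conjI)
qed

text \<open>The bound on \<open>y powr (p - 1)\<close> is what makes the next \<open>a\<close>
  positive, and the existence of the next root relies on \<open>0 < a \<le> 2\<close>; hence one
  induction for all the bounds.\<close>

lemma super_bounds:
  assumes "p > 2"
  shows "0 < a_super p k \<and> a_super p k \<le> 2 \<and> 0 < d_super p k \<and> d_super p k \<le> 1"
proof (induction k)
  case (Suc k)
  show ?case
  proof (cases "k = 0")
    case False
    hence k: "1 \<le> k" by simp
    from Suc.IH have IH: "0 < a_super p k" "a_super p k \<le> 2" "0 < d_super p k" by simp_all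
    obtain y where y: "0 < y" "y < 1" "d_super p (Suc k) = y * d_super p k"
      "a_super p (Suc k) = 2 - y powr (p - 1) * (2 + a_super p k)"
      "y powr (p - 1) < 2 / (2 + a_super p k)"
      using d_super_Suc[OF k IH assms] by (elim exE conjE) (rule that)
    have "y powr (p - 1) * (2 + a_super p k) < 2"
      using y(5) Suc.IH by (simp add: field_simps)
    moreover have "y powr (p - 1) * (2 + a_super p k) \<ge> 0"
      using Suc.IH by simp
    moreover have "y * d_super p k \<le> 1 * 1"
      using y Suc.IH by (intro mult_mono) auto
    ultimately show ?thesis
      using y Suc.IH by (simp del: a_super.simps d_super.simps)
  qed auto
qed auto

lemma e_crit_Suc:
  assumes "k \<ge> 1" "0 < a_crit k" "0 < e_crit k"
  shows "\<exists>y. 0 < y \<and> y < 1 \<and> e_crit (Suc k) = y * e_crit k \<and>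
    a_crit (Suc k) = 2 - y * (2 + a_crit k) \<and> y < 2 / (2 + a_crit k) \<and>
    (\<forall>x\<in>{y..1}. 2 / (2 + a_crit k) * ln (1 / x) - 1 + x \<le> 0)"
proof -
  obtain j where k: "k = Suc j" using assms(1) by (cases k) auto
  define a where "a = a_crit k"
  define d where "d = e_crit k"
  have d: "d > 0" and a: "0 < a" using assms by (auto simp: a_def d_def)
  obtain y where y: "0 < y" "y < 1" "2 / (2 + a) * ln (1 / y) - 1 + y = 0"
    "y < 2 / (2 + a)"
    "\<forall>x. 0 < x \<and> x < 1 \<and> 2 / (2 + a) * ln (1 / x) - 1 + x = 0 \<longrightarrow> x = y"
    "\<forall>x\<in>{y..1}. 2 / (2 + a) * ln (1 / x) - 1 + x \<le> 0"
    using crit_root[OF a] by (elim exE conjE) (rule that)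
  have "e_crit (Suc k) = (THE x. 0 < x \<and> x < d \<and> 2 / (2 + a) * ln (d / x) - 1 + x / d = 0)"
    by (simp add: k a_def d_def)
  also have "\<dots> = y * d"
  proof (rule the_equality)
    show "0 < y * d \<and> y * d < d \<and> 2 / (2 + a) * ln (d / (y * d)) - 1 + y * d / d = 0"
      using y(1-3) d by auto
    show "x = y * d"
      if "0 < x \<and> x < d \<and> 2 / (2 + a) * ln (d / x) - 1 + x / d = 0" for x
      using y(5)[rule_format, of "x / d"] that d by (auto simp: field_simps)
  qed
  finally have dS: "e_crit (Suc k) = y * d" .
  moreover have "a_crit (Suc k) = 2 - e_crit (Suc k) / d * (2 + a)"
    unfolding k a_def d_def by (simp only: a_crit.simps)
  ultimately have "e_crit (Suc k) = y * d" "a_crit (Suc k) = 2 - y * (2 + a)"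
    using d by simp_all
  thus ?thesis
    using y(1,2,4,6) unfolding a_def d_def by (intro exI[of _ y] conjI)
qed

lemma crit_bounds: "0 < a_crit k \<and> a_crit k \<le> 2 \<and> 0 < e_crit k \<and> e_crit k \<le> 1"
proof (induction k)
  case (Suc k)
  show ?case
  proof (cases "k = 0")
    case False
    hence k: "1 \<le> k" by simp
    from Suc.IH have IH: "0 < a_crit k" "0 < e_crit k" by simp_all
    obtain y where y: "0 < y" "y < 1" "e_crit (Suc k) = y * e_crit k"
      "a_crit (Suc k) = 2 - y * (2 + a_crit k)" "y < 2 / (2 + a_crit k)"
      using e_crit_Suc[OF k IH] by (elim exE conjE) (rule that)
    have "y * (2 + a_crit k) < 2"
      using y(5) Suc.IH by (simp add: field_simps)
    moreover have "y * (2 + a_crit k) \<ge> 0"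
      using Suc.IH y by simp
    moreover have "y * e_crit k \<le> 1 * 1"
      using y Suc.IH by (intro mult_mono) auto
    ultimately show ?thesis
      using y Suc.IH by (simp del: a_crit.simps e_crit.simps)
  qed auto
qed auto

section \<open>Range of the limit coefficients\<close>

lemma alpha_super_range:
  assumes "p > 2" "k \<ge> 1" "x \<in> {d_super p (Suc k)..d_super p k}"
  shows "1 - 2 * p / (2 + a_super p k) * (1 - x / d_super p k) > 0"
    and "alpha_super p k x \<in> {0<..2}"
proof -
  have b: "0 < a_super p k" "a_super p k \<le> 2" "0 < d_super p k"
    using super_bounds[OF assms(1), of k] by auto
  obtain y where y: "0 < y" "y < 1" "d_super p (Suc k) = y * d_super p k"
      "\<forall>x\<in>{y..1}. 2 * p / (2 + a_super p k) * (1 - x) - 1 + x powr p \<le> 0"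
    using d_super_Suc[OF assms(2) b assms(1)] by (elim exE conjE) (rule that)
  define s where "s = x / d_super p k"
  have s: "y \<le> s" "s \<le> 1"
    using assms(3) y(3) super_bounds[OF assms(1), of k] by (auto simp: s_def field_simps)
  \<comment> \<open>Nonpositivity of the convex function on \<open>{y..1}\<close> says that the
    denominator of \<open>alpha_super\<close> is at least \<open>s powr p\<close>; this yields both
    its positivity and the bound 2.\<close>
  have *: "1 - 2 * p / (2 + a_super p k) * (1 - s) \<ge> s powr p" "s powr p > 0"
    using y(4)[rule_format, of s] s y(1) by auto
  show "1 - 2 * p / (2 + a_super p k) * (1 - x / d_super p k) > 0"
    using * unfolding s_def by linarith
  thus "alpha_super p k x \<in> {0<..2}"
    using * unfolding alpha_super_def s_def[symmetric] by (simp add: divide_le_eq)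
qed

lemma alpha_crit_range:
  assumes "k \<ge> 1" "x \<in> {e_crit (Suc k)..e_crit k}"
  shows "1 - 2 / (2 + a_crit k) * ln (e_crit k / x) > 0"
    and "alpha_crit k x \<in> {0<..2}"
proof -
  have b: "0 < a_crit k" "0 < e_crit k"
    using crit_bounds[of k] by auto
  obtain y where y: "0 < y" "y < 1" "e_crit (Suc k) = y * e_crit k"
      "\<forall>x\<in>{y..1}. 2 / (2 + a_crit k) * ln (1 / x) - 1 + x \<le> 0"
    using e_crit_Suc[OF assms(1) b] by (elim exE conjE) (rule that)
  define s where "s = x / e_crit k"
  have s: "y \<le> s" "s \<le> 1"
    using assms(2) y(3) crit_bounds[of k] by (auto simp: s_def field_simps)
  have "e_crit k / x = 1 / s" by (simp add: s_def)
  have *: "1 - 2 / (2 + a_crit k) * ln (1 / s) \<ge> s" "s > 0"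
    using y(4)[rule_format, of s] s y(1) by auto
  show "1 - 2 / (2 + a_crit k) * ln (e_crit k / x) > 0"
    using * unfolding \<open>e_crit k / x = 1 / s\<close> by linarith
  thus "alpha_crit k x \<in> {0<..2}"
    using * unfolding alpha_crit_def \<open>e_crit k / x = 1 / s\<close> s_def[symmetric]
    by (simp add: divide_le_eq)
qed

section \<open>Growth functions\<close>

text \<open>Cauchy's mean value theorem for points in either order, possibly equal: it will compare
  values at \<open>mu n\<close> and at a second point that may lie on either side.\<close>

lemma cauchy_mvt_segment:
  fixes F G F' G' :: "real \<Rightarrow> real"
  assumes F: "\<And>z. z > S \<Longrightarrow> (F has_real_derivative F' z) (at z)"
    and G: "\<And>z. z > S \<Longrightarrow> (G has_real_derivative G' z) (at z)"
    and xy: "x > S" "y > S"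
  shows "\<exists>z\<in>{min x y..max x y}. (F y - F x) * G' z = (G y - G x) * F' z"
proof -
  have *: "\<exists>z\<in>{x..y}. (F y - F x) * G' z = (G y - G x) * F' z" if "S < x" "x < y" for x y
  proof -
    have "\<exists>z. x < z \<and> z < y \<and> (F y - F x) * G' z = (G y - G x) * F' z"
      using that by (intro GMVT') (auto intro: F G DERIV_isCont[OF F] DERIV_isCont[OF G])
    thus ?thesis by (meson atLeastAtMost_iff less_imp_le)
  qed
  show ?thesis
  proof (cases x y rule: linorder_cases)
    case greater
    obtain z where z: "z \<in> {y..x}" "(F x - F y) * G' z = (G x - G y) * F' z"
      using *[of y x] greater xy by auto
    have "(F y - F x) * G' z = (G y - G x) * F' z"
      using z(2) by (simp add: algebra_simps)
    thus ?thesis using z(1) greater by (intro bexI[of _ z]) auto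
  qed (use *[of x y] xy in auto)
qed

lemma filterlim_at_top_between:
  fixes x y z :: "'a \<Rightarrow> real"
  assumes "filterlim x at_top A" "filterlim y at_top A" "\<forall>\<^sub>F n in A. z n \<ge> min (x n) (y n)"
  shows "filterlim z at_top A"
  unfolding filterlim_at_top
proof
  fix C
  have "\<forall>\<^sub>F n in A. x n \<ge> C" "\<forall>\<^sub>F n in A. y n \<ge> C"
    using assms(1,2) by (auto simp: filterlim_at_top)
  with assms(3) show "\<forall>\<^sub>F n in A. C \<le> z n"
    by eventually_elim auto
qed

text \<open>The part of the growth condition that concerns \<open>g\<close> alone, on the open
  half-line beyond \<open>T\<close>, where derivatives are two-sided.\<close>

locale growth =
  fixes g g' g'' :: "real \<Rightarrow> real" and T q :: real
  assumes dg: "t > T \<Longrightarrow> (g has_real_derivative g' t) (at t)"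
    and dg': "t > T \<Longrightarrow> (g' has_real_derivative g'' t) (at t)"
    and g'_pos: "t > T \<Longrightarrow> g' t > 0" and g''_pos: "t > T \<Longrightarrow> g'' t > 0"
    and q_ge1: "q \<ge> 1"
    and lim_q: "((\<lambda>t. (g' t)\<^sup>2 / (g t * g'' t)) \<longlongrightarrow> q) at_top"
begin

text \<open>The reciprocal of the logarithmic derivative of \<open>g\<close>; for q = 1 it is the
  auxiliary function of de Haan's class Gamma.\<close>

definition w :: "real \<Rightarrow> real" where "w t = g t / g' t"
definition w' :: "real \<Rightarrow> real" where "w' t = 1 - g t * g'' t / (g' t)\<^sup>2"

lemma g'_mono:
  assumes "T < s" "s \<le> t"
  shows "g' s \<le> g' t"
proof (rule DERIV_nonneg_imp_nondecreasing[OF assms(2)])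
  show "\<exists>y. (g' has_real_derivative y) (at x) \<and> 0 \<le> y" if "s \<le> x" "x \<le> t" for x
    using dg'[of x] g''_pos[of x] that assms by (intro exI[of _ "g'' x"]) auto
qed

lemma g_at_top: "filterlim g at_top at_top"
proof -
  have "g t \<ge> g (T + 1) + g' (T + 1) * (- (T + 1) + t)" if "t > T + 1" for t
  proof -
    have "\<exists>z>T + 1. z < t \<and> g t - g (T + 1) = (t - (T + 1)) * g' z"
      using that dg by (intro MVT2) auto
    then obtain z where z: "z > T + 1" "g t - g (T + 1) = (t - (T + 1)) * g' z" by blast
    have "(t - (T + 1)) * g' (T + 1) \<le> (t - (T + 1)) * g' z"
      using z that by (intro mult_left_mono g'_mono) auto
    thus ?thesis using z(2) by (simp add: algebra_simps)
  qed
  hence ev: "\<forall>\<^sub>F t in at_top. g t \<ge> g (T + 1) + g' (T + 1) * (- (T + 1) + t)"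
    by (intro eventually_mono[OF eventually_gt_at_top[of "T + 1"]])
  have "filterlim (\<lambda>t. g (T + 1) + g' (T + 1) * (- (T + 1) + t)) at_top at_top"
    using g'_pos[of "T + 1"]
    by (intro filterlim_tendsto_add_at_top[OF tendsto_const] filterlim_ident
        filterlim_tendsto_pos_mult_at_top[OF tendsto_const]) auto
  thus ?thesis using ev by (rule filterlim_at_top_mono)
qed

lemma eventually_pos: "\<forall>\<^sub>F t in at_top. t > T \<and> t > 0 \<and> g t > 0"
  using eventually_gt_at_top[of T] eventually_gt_at_top[of 0]
    g_at_top[unfolded filterlim_at_top_dense, rule_format, of 0]
  by eventually_elim auto

text \<open>By l'Hospital: the quotient of the derivatives is \<open>g'' t / (g' t)\<^sup>2\<close>,
  the inverse of the product of \<open>g t\<close> and the quotient in \<open>lim_q\<close>, and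
  \<open>g\<close> diverges.\<close>

lemma ln_g'_over_g: "((\<lambda>t. ln (g' t) / g t) \<longlongrightarrow> 0) at_top"
proof (rule lhospital_at_top_at_top[OF g_at_top])
  show "\<forall>\<^sub>F t in at_top. g' t \<noteq> 0"
    using eventually_gt_at_top[of T] by eventually_elim (use g'_pos in force)
  show "\<forall>\<^sub>F t in at_top. ((\<lambda>t. ln (g' t)) has_real_derivative g'' t / g' t) (at t)"
    using eventually_gt_at_top[of T]
    by eventually_elim (auto intro!: derivative_eq_intros dg' g'_pos)
  show "\<forall>\<^sub>F t in at_top. (g has_real_derivative g' t) (at t)"
    using eventually_gt_at_top[of T] by eventually_elim (rule dg)
  have "filterlim (\<lambda>t. (g' t)\<^sup>2 / (g t * g'' t) * g t) at_top at_top"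
    using lim_q q_ge1 g_at_top by (intro filterlim_tendsto_pos_mult_at_top) auto
  hence "((\<lambda>t. inverse ((g' t)\<^sup>2 / (g t * g'' t) * g t)) \<longlongrightarrow> 0) at_top"
    by (rule tendsto_inverse_0_at_top)
  moreover have "\<forall>\<^sub>F t in at_top. inverse ((g' t)\<^sup>2 / (g t * g'' t) * g t) = g'' t / g' t / g' t"
    using eventually_pos by eventually_elim (auto simp: power2_eq_square field_simps)
  ultimately show "((\<lambda>t. g'' t / g' t / g' t) \<longlongrightarrow> 0) at_top"
    by (rule Lim_transform_eventually)
qed

lemma dw: "t > T \<Longrightarrow> (w has_real_derivative w' t) (at t)"
  unfolding w_def w'_def using g'_pos[of t] dg[of t] dg'[of t]
  by (auto intro!: derivative_eq_intros simp: power2_eq_square field_simps)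

lemma w'_lim: "(w' \<longlongrightarrow> 1 - 1 / q) at_top"
proof -
  have "((\<lambda>t. 1 - inverse ((g' t)\<^sup>2 / (g t * g'' t))) \<longlongrightarrow> 1 - inverse q) at_top"
    using lim_q q_ge1 by (intro tendsto_intros) auto
  thus ?thesis unfolding w'_def by (simp add: inverse_eq_divide)
qed

lemma w_over_id: "((\<lambda>t. w t / t) \<longlongrightarrow> 1 - 1 / q) at_top"
proof (rule lhospital_at_top_at_top)
  show "\<forall>\<^sub>F t in at_top. (w has_real_derivative w' t) (at t)"
    using eventually_gt_at_top[of T] by eventually_elim (rule dw)
  show "\<forall>\<^sub>F t in at_top. ((\<lambda>t. t) has_real_derivative 1) (at t)"
    by (auto intro!: always_eventually derivative_eq_intros)
qed (use w'_lim in \<open>auto simp: filterlim_ident\<close>)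

text \<open>For \<open>q > 1\<close>, \<open>g\<close> varies regularly with the conjugate index \<open>p = q / (q - 1)\<close>.\<close>

lemma elasticity_lim:
  assumes "q > 1" "p = q / (q - 1)"
  shows "((\<lambda>t. t * g' t / g t) \<longlongrightarrow> p) at_top"
proof -
  have "((\<lambda>t. inverse (w t / t)) \<longlongrightarrow> inverse (1 - 1 / q)) at_top"
    using w_over_id assms by (intro tendsto_inverse) auto
  moreover have "inverse (1 - 1 / q) = p"
    using assms by (simp add: field_simps)
  ultimately show ?thesis by (simp add: w_def mult.commute)
qed

text \<open>Comparing \<open>ln g\<close> with \<open>ln\<close> by Cauchy's theorem writes the
  ratio of values of \<open>g\<close> as \<open>t n / mu n\<close> raised to the elasticity
  \<open>L\<close> at an intermediate point. The ratio of derivatives follows from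
  \<open>g' = L g / t\<close>.\<close>

lemma regular_variation:
  assumes q: "q > 1" "p = q / (q - 1)" and mu: "filterlim mu at_top sequentially"
    and lim: "(\<lambda>n. t n / mu n) \<longlonglongrightarrow> d" and d: "d > 0"
  shows "filterlim t at_top sequentially"
    and "(\<lambda>n. g (t n) / g (mu n)) \<longlonglongrightarrow> d powr p"
    and "(\<lambda>n. g' (t n) / g' (mu n)) \<longlonglongrightarrow> d powr (p - 1)"
proof -
  obtain S where S: "\<And>z. z > S \<Longrightarrow> z > T \<and> z > 0 \<and> g z > 0"
    using eventually_pos unfolding eventually_at_top_dense by blast
  define L where "L z = z * g' z / g z" for z
  have L: "(L \<longlongrightarrow> p) at_top" unfolding L_def using elasticity_lim[OF q] .
  have "filterlim (\<lambda>n. t n / mu n * mu n) at_top sequentially"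
    using lim d mu by (rule filterlim_tendsto_pos_mult_at_top)
  moreover have muS: "\<forall>\<^sub>F n in sequentially. mu n > S"
    using mu by (simp add: filterlim_at_top_dense)
  hence "\<forall>\<^sub>F n in sequentially. t n / mu n * mu n = t n"
    by eventually_elim (use S in force)
  ultimately show t: "filterlim t at_top sequentially"
    by (simp add: filterlim_cong)
  hence tS: "\<forall>\<^sub>F n in sequentially. t n > S"
    by (simp add: filterlim_at_top_dense)
  have "\<forall>n. \<exists>z. mu n > S \<and> t n > S \<longrightarrow> z \<in> {min (mu n) (t n)..max (mu n) (t n)} \<and>
      ln (g (t n)) - ln (g (mu n)) = L z * (ln (t n) - ln (mu n))"
  proof (intro allI)
    fix n
    show "\<exists>z. mu n > S \<and> t n > S \<longrightarrow> z \<in> {min (mu n) (t n)..max (mu n) (t n)} \<and>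
      ln (g (t n)) - ln (g (mu n)) = L z * (ln (t n) - ln (mu n))"
    proof (cases "mu n > S \<and> t n > S")
      case True
      have "\<exists>z\<in>{min (mu n) (t n)..max (mu n) (t n)}.
          (ln (g (t n)) - ln (g (mu n))) * (1 / z) = (ln (t n) - ln (mu n)) * (g' z / g z)"
        using True S by (intro cauchy_mvt_segment[where S = S]) (auto intro!: derivative_eq_intros dg)
      then obtain z where z: "z \<in> {min (mu n) (t n)..max (mu n) (t n)}"
          "(ln (g (t n)) - ln (g (mu n))) * (1 / z) = (ln (t n) - ln (mu n)) * (g' z / g z)" by blast
      moreover have "z > 0" using z(1) True S[of z] by auto
      hence "ln (g (t n)) - ln (g (mu n)) = L z * (ln (t n) - ln (mu n))"
        using z(2) by (simp add: L_def field_simps)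
      ultimately show ?thesis by blast
    qed auto
  qed
  then obtain z where z: "\<And>n. mu n > S \<and> t n > S \<longrightarrow> z n \<in> {min (mu n) (t n)..max (mu n) (t n)} \<and>
      ln (g (t n)) - ln (g (mu n)) = L (z n) * (ln (t n) - ln (mu n))"
    by metis
  have "\<forall>\<^sub>F n in sequentially. z n \<ge> min (mu n) (t n)"
    using muS tS by eventually_elim (use z in auto)
  hence "filterlim z at_top sequentially"
    by (rule filterlim_at_top_between[OF mu t])
  hence "(\<lambda>n. exp (L (z n) * ln (t n / mu n))) \<longlonglongrightarrow> exp (p * ln d)"
    using filterlim_compose[OF L] lim d by (intro tendsto_intros) auto
  moreover have "\<forall>\<^sub>F n in sequentially. exp (L (z n) * ln (t n / mu n)) = g (t n) / g (mu n)"
    using muS tS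
  proof eventually_elim
    case (elim n)
    have "ln (t n / mu n) = ln (t n) - ln (mu n)"
      using elim S[of "t n"] S[of "mu n"] by (simp add: ln_div)
    hence "exp (L (z n) * ln (t n / mu n)) = exp (ln (g (t n)) - ln (g (mu n)))"
      using z[of n] elim by simp
    also have "\<dots> = g (t n) / g (mu n)"
      using elim S by (simp add: exp_diff)
    finally show ?case .
  qed
  ultimately have "(\<lambda>n. g (t n) / g (mu n)) \<longlonglongrightarrow> exp (p * ln d)"
    by (rule Lim_transform_eventually)
  thus g: "(\<lambda>n. g (t n) / g (mu n)) \<longlonglongrightarrow> d powr p"
    using d by (simp add: powr_def)
  have "p > 0" using q by simp
  have "(\<lambda>n. L (t n) / L (mu n) * (g (t n) / g (mu n)) / (t n / mu n)) \<longlonglongrightarrow> p / p * d powr p / d"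
    using \<open>p > 0\<close> d by (intro tendsto_intros filterlim_compose[OF L] t mu g lim) auto
  moreover have "p / p * d powr p / d = d powr (p - 1)"
    using \<open>p > 0\<close> d by (simp add: powr_diff)
  moreover have "\<forall>\<^sub>F n in sequentially.
      L (t n) / L (mu n) * (g (t n) / g (mu n)) / (t n / mu n) = g' (t n) / g' (mu n)"
    using muS tS
  proof eventually_elim
    case (elim n)
    have "g (t n) > 0" "g (mu n) > 0" "t n > 0" "mu n > 0" using S elim by auto
    thus ?case by (simp add: L_def)
  qed
  ultimately show "(\<lambda>n. g' (t n) / g' (mu n)) \<longlonglongrightarrow> d powr (p - 1)"
    by (auto intro: Lim_transform_eventually)
qed

text \<open>For \<open>q = 1\<close>, \<open>w\<close> is self-neglecting since \<open>w' \<rightarrow> 0\<close>.\<close>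

lemma gamma_variation:
  assumes q: "q = 1" and mu: "filterlim mu at_top sequentially"
    and lim: "(\<lambda>n. (mu n - t n) / w (mu n)) \<longlonglongrightarrow> c"
  shows "filterlim t at_top sequentially"
    and "(\<lambda>n. g (t n) / g (mu n)) \<longlonglongrightarrow> exp (- c)"
    and "(\<lambda>n. g' (t n) / g' (mu n)) \<longlonglongrightarrow> exp (- c)"
proof -
  obtain S where S: "\<And>z. z > S \<Longrightarrow> z > T \<and> z > 0 \<and> g z > 0"
    using eventually_pos unfolding eventually_at_top_dense by blast
  have w_pos: "w z > 0" if "z > S" for z
    using S[OF that] g'_pos by (simp add: w_def)
  have muS: "\<forall>\<^sub>F n in sequentially. mu n > S"
    using mu by (simp add: filterlim_at_top_dense)
  \<comment> \<open>\<open>t n / mu n\<close> tends to 1, since \<open>mu n - t n\<close> is of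
    order \<open>w (mu n)\<close>, which is small against \<open>mu n\<close> for q = 1.\<close>
  have "(\<lambda>n. 1 - (mu n - t n) / w (mu n) * (w (mu n) / mu n)) \<longlonglongrightarrow> 1 - c * (1 - 1 / q)"
    by (intro tendsto_intros lim filterlim_compose[OF w_over_id] mu)
  hence "filterlim (\<lambda>n. (1 - (mu n - t n) / w (mu n) * (w (mu n) / mu n)) * mu n) at_top sequentially"
    using q mu by (intro filterlim_tendsto_pos_mult_at_top[of _ 1]) auto
  moreover have "\<forall>\<^sub>F n in sequentially.
      (1 - (mu n - t n) / w (mu n) * (w (mu n) / mu n)) * mu n = t n"
    using muS
  proof eventually_elim
    case (elim n)
    show ?case using S[OF elim] w_pos[OF elim] by (simp add: field_simps)
  qed
  ultimately show t: "filterlim t at_top sequentially"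
    by (simp add: filterlim_cong)
  hence tS: "\<forall>\<^sub>F n in sequentially. t n > S"
    by (simp add: filterlim_at_top_dense)
  \<comment> \<open>\<open>w\<close> is asymptotically constant between \<open>mu n\<close> and
    \<open>t n\<close>: its increment is a value of \<open>w'\<close>, tending to 0, times a
    distance of order \<open>w (mu n)\<close>.\<close>
  have w_ratio: "(\<lambda>n. w (x n) / w (mu n)) \<longlonglongrightarrow> 1"
    if x: "\<forall>\<^sub>F n in sequentially. x n \<in> {min (mu n) (t n)..max (mu n) (t n)}" for x
  proof -
    have "\<forall>n. \<exists>z. mu n > S \<and> x n > S \<longrightarrow> z \<in> {min (mu n) (x n)..max (mu n) (x n)} \<and>
        w (x n) - w (mu n) = w' z * (x n - mu n)"
    proof (intro allI)
      fix n
      show "\<exists>z. mu n > S \<and> x n > S \<longrightarrow> z \<in> {min (mu n) (x n)..max (mu n) (x n)} \<and>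
        w (x n) - w (mu n) = w' z * (x n - mu n)"
      proof (cases "mu n > S \<and> x n > S")
        case True
        have "\<exists>z\<in>{min (mu n) (x n)..max (mu n) (x n)}.
            (w (x n) - w (mu n)) * 1 = (x n - mu n) * w' z"
          using True S by (intro cauchy_mvt_segment[where S = S]) (auto intro!: derivative_eq_intros dw)
        thus ?thesis by (auto simp: mult.commute)
      qed auto
    qed
    then obtain z where z: "\<And>n. mu n > S \<and> x n > S \<longrightarrow> z n \<in> {min (mu n) (x n)..max (mu n) (x n)} \<and>
        w (x n) - w (mu n) = w' (z n) * (x n - mu n)"
      by metis
    have "\<forall>\<^sub>F n in sequentially. min (mu n) (t n) \<le> x n"
      using x by eventually_elim auto
    hence xtop: "filterlim x at_top sequentially"
      by (rule filterlim_at_top_between[OF mu t])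
    hence xS: "\<forall>\<^sub>F n in sequentially. x n > S"
      by (simp add: filterlim_at_top_dense)
    have "\<forall>\<^sub>F n in sequentially. min (mu n) (x n) \<le> z n"
      using muS xS by eventually_elim (use z in auto)
    hence "filterlim z at_top sequentially"
      by (rule filterlim_at_top_between[OF mu xtop])
    hence "(\<lambda>n. \<bar>w' (z n)\<bar> * \<bar>(mu n - t n) / w (mu n)\<bar>) \<longlonglongrightarrow> \<bar>1 - 1 / q\<bar> * \<bar>c\<bar>"
      by (intro tendsto_intros lim filterlim_compose[OF w'_lim])
    hence "(\<lambda>n. \<bar>w' (z n)\<bar> * \<bar>(mu n - t n) / w (mu n)\<bar>) \<longlonglongrightarrow> 0"
      using q by simp
    moreover have "\<forall>\<^sub>F n in sequentially.
        norm (w (x n) / w (mu n) - 1) \<le> \<bar>w' (z n)\<bar> * \<bar>(mu n - t n) / w (mu n)\<bar>"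
      using muS xS x
    proof eventually_elim
      case (elim n)
      have w0: "w (mu n) > 0" using w_pos elim by simp
      hence "w (x n) / w (mu n) - 1 = w' (z n) * (x n - mu n) / w (mu n)"
        using z[of n] elim by (simp add: field_simps)
      hence "norm (w (x n) / w (mu n) - 1) = \<bar>w' (z n)\<bar> * (\<bar>x n - mu n\<bar> / w (mu n))"
        using w0 by (simp add: abs_mult)
      also have "\<dots> \<le> \<bar>w' (z n)\<bar> * (\<bar>mu n - t n\<bar> / w (mu n))"
        using elim w0 by (intro mult_left_mono divide_right_mono) auto
      finally show ?case using w0 by simp
    qed
    ultimately have "(\<lambda>n. w (x n) / w (mu n) - 1) \<longlonglongrightarrow> 0"
      by (rule Lim_null_comparison[rotated])
    thus ?thesis by (simp add: LIM_zero_iff)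
  qed
  \<comment> \<open>The derivative of \<open>ln g\<close> is \<open>1 / w\<close>, so the change of
    \<open>ln g\<close> is \<open>t n - mu n\<close> over a value of \<open>w\<close> on the
    segment, which \<open>w_ratio\<close> lets one replace by \<open>w (mu n)\<close>.\<close>
  have "\<forall>n. \<exists>z. mu n > S \<and> t n > S \<longrightarrow> z \<in> {min (mu n) (t n)..max (mu n) (t n)} \<and>
      ln (g (t n)) - ln (g (mu n)) = (t n - mu n) / w z"
  proof (intro allI)
    fix n
    show "\<exists>z. mu n > S \<and> t n > S \<longrightarrow> z \<in> {min (mu n) (t n)..max (mu n) (t n)} \<and>
      ln (g (t n)) - ln (g (mu n)) = (t n - mu n) / w z"
    proof (cases "mu n > S \<and> t n > S")
      case True
      have "\<exists>z\<in>{min (mu n) (t n)..max (mu n) (t n)}.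
          (ln (g (t n)) - ln (g (mu n))) * 1 = (t n - mu n) * (g' z / g z)"
        using True S by (intro cauchy_mvt_segment[where S = S]) (auto intro!: derivative_eq_intros dg)
      thus ?thesis by (auto simp: w_def)
    qed auto
  qed
  then obtain z where z: "\<And>n. mu n > S \<and> t n > S \<longrightarrow> z n \<in> {min (mu n) (t n)..max (mu n) (t n)} \<and>
      ln (g (t n)) - ln (g (mu n)) = (t n - mu n) / w (z n)"
    by metis
  have zev: "\<forall>\<^sub>F n in sequentially. z n \<in> {min (mu n) (t n)..max (mu n) (t n)}"
    using muS tS by eventually_elim (use z in auto)
  have "(\<lambda>n. exp (- ((mu n - t n) / w (mu n)) / (w (z n) / w (mu n)))) \<longlonglongrightarrow> exp (- c / 1)"
    by (intro tendsto_intros lim w_ratio zev) auto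
  moreover have "\<forall>\<^sub>F n in sequentially.
      exp (- ((mu n - t n) / w (mu n)) / (w (z n) / w (mu n))) = g (t n) / g (mu n)"
    using muS tS
  proof eventually_elim
    case (elim n)
    have "w (mu n) > 0" "w (z n) > 0"
      using elim z[of n] by (auto intro!: w_pos)
    hence "- ((mu n - t n) / w (mu n)) / (w (z n) / w (mu n)) = (t n - mu n) / w (z n)"
      by (simp add: field_simps)
    hence "exp (- ((mu n - t n) / w (mu n)) / (w (z n) / w (mu n))) = exp (ln (g (t n)) - ln (g (mu n)))"
      using z[of n] elim by presburger
    also have "\<dots> = g (t n) / g (mu n)"
      using elim S by (simp add: exp_diff)
    finally show ?case .
  qed
  ultimately have g: "(\<lambda>n. g (t n) / g (mu n)) \<longlonglongrightarrow> exp (- c / 1)"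
    by (rule Lim_transform_eventually)
  thus "(\<lambda>n. g (t n) / g (mu n)) \<longlonglongrightarrow> exp (- c)" by simp
  have "(\<lambda>n. g (t n) / g (mu n) / (w (t n) / w (mu n))) \<longlonglongrightarrow> exp (- c / 1) / 1"
    by (intro tendsto_intros g w_ratio) auto
  moreover have "\<forall>\<^sub>F n in sequentially. g (t n) / g (mu n) / (w (t n) / w (mu n)) = g' (t n) / g' (mu n)"
    using muS tS
  proof eventually_elim
    case (elim n)
    have "g (t n) > 0" "g (mu n) > 0" "g' (t n) > 0" "g' (mu n) > 0" using S elim g'_pos by auto
    thus ?case by (simp add: w_def field_simps)
  qed
  ultimately show "(\<lambda>n. g' (t n) / g' (mu n)) \<longlonglongrightarrow> exp (- c)"
    by (auto intro: Lim_transform_eventually)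
qed

end

section \<open>Concentration sequences\<close>

lemma deriv_on_eq:
  assumes "x \<in> interior S" "(f has_real_derivative D) (at x)"
  shows "deriv_on S f x = D"
proof -
  have "(f has_vector_derivative D) (at x)"
    using assms(2) by (simp only: has_real_derivative_iff_has_vector_derivative)
  thus ?thesis
    unfolding deriv_on_def at_within_interior[OF assms(1)] by (rule vector_derivative_at)
qed

lemma deriv_on_DERIV:
  assumes "f differentiable_on S" "x \<in> interior S"
  shows "(f has_real_derivative deriv_on S f x) (at x)"
proof -
  have "x \<in> S" using assms(2) interior_subset by blast
  hence "f differentiable (at x within S)" using assms(1) by (simp add: differentiable_on_def)
  thus ?thesis
    unfolding deriv_on_def has_real_derivative_iff_has_vector_derivative
    by (simp only: vector_derivative_works at_within_interior[OF assms(2)])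
qed

lemma sup_vanishesD:
  assumes "sup_vanishes A F" "\<forall>\<^sub>F n in sequentially. x n \<in> A n"
  shows "(\<lambda>n. F n (x n)) \<longlonglongrightarrow> 0"
proof (rule tendstoI)
  fix e :: real assume "e > 0"
  hence "\<forall>\<^sub>F n in sequentially. \<forall>r\<in>A n. \<bar>F n r\<bar> \<le> e / 2"
    using assms(1) half_gt_zero unfolding sup_vanishes_def by blast
  with assms(2) show "\<forall>\<^sub>F n in sequentially. dist (F n (x n)) 0 < e"
    by eventually_elim (use \<open>e > 0\<close> in force)
qed

lemma eq_coeff_tendsto:
  assumes "eq_coeff X c Y" "\<forall>\<^sub>F n in sequentially. Y n \<noteq> 0"
  shows "(\<lambda>n. X n / Y n) \<longlonglongrightarrow> c"
proof -
  obtain e where e: "e \<longlonglongrightarrow> 0" "\<forall>\<^sub>F n in sequentially. X n = (c + e n) * Y n"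
    using assms(1) unfolding eq_coeff_def by blast
  have "(\<lambda>n. c + e n) \<longlonglongrightarrow> c + 0"
    by (intro tendsto_intros e)
  moreover have "\<forall>\<^sub>F n in sequentially. c + e n = X n / Y n"
    using e(2) assms(2) by eventually_elim simp
  ultimately show ?thesis
    by (auto intro: Lim_transform_eventually)
qed

text \<open>A common gauge \<open>G\<close> turns an asymptotic relation into two limits; below it
  is always \<open>g (mu n)\<close>.\<close>

lemma eq_coeffI:
  assumes X: "(\<lambda>n. X n / G n) \<longlonglongrightarrow> A" and Y: "(\<lambda>n. Y n / G n) \<longlonglongrightarrow> B" and "B \<noteq> 0"
    and "\<forall>\<^sub>F n in sequentially. G n \<noteq> 0" "c = A / B"
  shows "eq_coeff X c Y"
  unfolding eq_coeff_def
proof (intro exI conjI)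
  have "(\<lambda>n. X n / G n / (Y n / G n) - c) \<longlonglongrightarrow> A / B - c"
    by (intro tendsto_intros X Y \<open>B \<noteq> 0\<close>)
  thus "(\<lambda>n. X n / G n / (Y n / G n) - c) \<longlonglongrightarrow> 0"
    using assms(5) by simp
  have "\<forall>\<^sub>F n in sequentially. Y n / G n \<noteq> 0"
    using tendsto_imp_eventually_ne[OF Y \<open>B \<noteq> 0\<close>] .
  with assms(4) show "\<forall>\<^sub>F n in sequentially. X n = (c + (X n / G n / (Y n / G n) - c)) * Y n"
    by eventually_elim auto
qed

locale concentration =
  fixes h f :: "real \<Rightarrow> real" and t0 q :: real and p :: ereal
    and lam mu :: "nat \<Rightarrow> real" and u :: "nat \<Rightarrow> real \<Rightarrow> real"
    and r \<gamma> \<rho> \<sigma> :: "nat \<Rightarrow> nat \<Rightarrow> real"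
  assumes nonlin: "nonlinearity h f t0"
    and gen_growth: "gen_exp_growth f t0 q p"
    and sol: "solution_seq h f lam mu u"
    and mu_top: "filterlim mu at_top sequentially"
    and conc: "concentration_seqs h f t0 q (real_of_ereal p) lam mu u r \<gamma> \<rho> \<sigma>"
    and q_range: "1 \<le> q" "q < 2"
begin

text \<open>For \<open>p = \<infinity>\<close> the value is \<open>0\<close>; this can occur only
  for \<open>q = 1\<close>, where the constants take their critical branch.\<close>

abbreviation P :: real where "P \<equiv> real_of_ereal p"
abbreviation g :: "real \<Rightarrow> real" where "g \<equiv> log_f f"
abbreviation g' :: "real \<Rightarrow> real" where "g' \<equiv> deriv_on {t0..} g"
abbreviation g'' :: "real \<Rightarrow> real" where "g'' \<equiv> deriv_on {t0..} g'"
abbreviation a :: "nat \<Rightarrow> real" where "a \<equiv> a_seq q P"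
abbreviation b :: "nat \<Rightarrow> real" where "b \<equiv> b_seq q P"
abbreviation \<eta> :: "nat \<Rightarrow> real" where "\<eta> \<equiv> eta_seq q P"

section \<open>Transfer of the hypotheses on \<open>f\<close> to \<open>g\<close>\<close>

lemma f_facts:
  assumes "t > t0"
  shows "f t > 0" "(f has_real_derivative deriv_on {t0..} f t) (at t)"
    "(deriv_on {t0..} f has_real_derivative deriv_on {t0..} (deriv_on {t0..} f) t) (at t)"
  using nonlin assms unfolding nonlinearity_def C2_on_def C1_on_def
  by (auto intro!: deriv_on_DERIV)

lemma g'_eq: "t > t0 \<Longrightarrow> g' t = deriv_on {t0..} f t / f t"
  using f_facts[of t] by (intro deriv_on_eq) (auto simp: log_f_def[abs_def] intro!: derivative_eq_intros)

text \<open>The sequences involve the derivative of \<open>f\<close> relative to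
  \<open>{0..}\<close>, whereas \<open>g'\<close> is relative to \<open>{t0..}\<close>; beyond
  \<open>t0\<close> both are ordinary derivatives.\<close>

lemma deriv_f_eq:
  assumes "t > t0"
  shows "deriv_on {0..} f t = f t * g' t"
proof -
  have "t > 0" using assms nonlin by (auto simp: nonlinearity_def)
  hence "deriv_on {0..} f t = deriv_on {t0..} f t"
    using f_facts[OF assms] by (intro deriv_on_eq) auto
  thus ?thesis using f_facts(1)[OF assms] g'_eq[OF assms] by simp
qed

sublocale growth g g' g'' t0 q
proof
  fix t assume t: "t > t0"
  have "(g has_real_derivative deriv_on {t0..} f t / f t) (at t)"
    using f_facts[OF t] by (auto simp: log_f_def[abs_def] intro!: derivative_eq_intros)
  thus "(g has_real_derivative g' t) (at t)"
    using g'_eq[OF t] by simp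
  have "((\<lambda>t. deriv_on {t0..} f t / f t) has_real_derivative
      (deriv_on {t0..} (deriv_on {t0..} f) t * f t - deriv_on {t0..} f t * deriv_on {t0..} f t) / (f t * f t)) (at t)"
    using f_facts[OF t] by (intro DERIV_divide) auto
  hence "(g' has_real_derivative
      (deriv_on {t0..} (deriv_on {t0..} f) t * f t - deriv_on {t0..} f t * deriv_on {t0..} f t) / (f t * f t)) (at t)"
    by (rule has_field_derivative_transform_within_open[where S = "{t0<..}"]) (use t g'_eq in auto)
  thus "(g' has_real_derivative g'' t) (at t)"
    using deriv_on_eq[of t "{t0..}" g'] t by simp
  show "g' t > 0" "g'' t > 0"
    using gen_growth t unfolding gen_exp_growth_def Let_def by auto
next
  show "1 \<le> q" by (rule q_range)
  show "((\<lambda>t. (g' t)\<^sup>2 / (g t * g'' t)) \<longlongrightarrow> q) at_top"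
    using gen_growth unfolding gen_exp_growth_def Let_def by auto
qed

text \<open>The elasticity of \<open>g\<close> tends to \<open>p\<close> by hypothesis and to
  \<open>q / (q - 1)\<close> by \<open>elasticity_lim\<close>; limits are unique.\<close>

lemma P_conjugate:
  assumes "q > 1"
  shows "P = q / (q - 1)" "P > 2"
proof -
  have p: "p > 0" "p < \<infinity>" and lim: "((\<lambda>t. ereal (t * g' t / g t)) \<longlongrightarrow> p) at_top"
    using gen_growth assms unfolding gen_exp_growth_def Let_def by auto
  have "((\<lambda>t. ereal (t * g' t / g t)) \<longlongrightarrow> ereal P) at_top"
    using lim p by (simp add: ereal_real)
  hence "((\<lambda>t. t * g' t / g t) \<longlongrightarrow> P) at_top" by simp
  thus P: "P = q / (q - 1)"
    using elasticity_lim[OF assms refl] tendsto_unique[OF trivial_limit_at_top_linorder] by blast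
  show "P > 2"
    unfolding P using assms q_range by (simp add: field_simps)
qed

text \<open>\<open>c k\<close> and \<open>G k\<close> are the limits of \<open>(\<mu>\<^sub>n - u\<^sub>n(s\<^sub>n)) / w(\<mu>\<^sub>n)\<close> and
  \<open>g'(u\<^sub>n(s\<^sub>n)) / g'(\<mu>\<^sub>n)\<close> at the \<open>k\<close>-th level; they allow to treat \<open>q = 1\<close> and \<open>q > 1\<close> together.\<close>

definition c :: "nat \<Rightarrow> real" where
  "c k = (if q = 1 then ln (1 / e_crit k) else P * (1 - d_super P k))"

definition G :: "nat \<Rightarrow> real" where
  "G k = (if q = 1 then e_crit k else d_super P k powr (P - 1))"

lemma q_cases: "q = 1 \<or> q > 1"
  using q_range by linarith

lemma crit_values:
  assumes "q = 1"
  shows "a k = a_crit k" "c k = ln (1 / e_crit k)" "G k = e_crit k" "\<eta> k = e_crit k"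
  using assms by (simp_all add: a_seq_def c_def[unfolded assms] G_def[unfolded assms] eta_seq_def)

lemma super_values:
  assumes "q > 1"
  shows "a k = a_super P k" "c k = P * (1 - d_super P k)" "G k = d_super P k powr (P - 1)"
    "\<eta> k = d_super P k powr P"
  using assms by (simp_all add: a_seq_def c_def G_def eta_seq_def)

lemma
  shows a_pos: "0 < a k" and G_pos: "G k > 0" and eta_pos: "\<eta> k > 0"
    and b_pos: "b k > 0" and c_nonneg: "c k \<ge> 0"
  using crit_bounds[of k] super_bounds[of P k] P_conjugate q_cases
  by (auto simp: a_seq_def G_def eta_seq_def b_seq_def c_def intro!: ln_ge_zero mult_nonneg_nonneg)

text \<open>If \<open>y\<close> is the ratio of consecutive \<open>e_crit\<close> (q = 1) or
  \<open>d_super\<close> (q > 1), then \<open>G (Suc k) / G k\<close> is \<open>y\<close> or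
  \<open>y powr (P - 1)\<close>, the factor in the recursion for \<open>a\<close>; \<open>c\<close>
  grows because \<open>y < 1\<close>.\<close>

lemma
  assumes k: "k \<ge> 1"
  shows a_Suc: "a (Suc k) = 2 - G (Suc k) / G k * (2 + a k)"
    and c_Suc: "c k < c (Suc k)"
proof -
  have "a (Suc k) = 2 - G (Suc k) / G k * (2 + a k) \<and> c k < c (Suc k)"
  proof (cases "q = 1")
    case True
    have e: "0 < a_crit k" "0 < e_crit k"
      using crit_bounds[of k] by auto
    obtain y where y: "0 < y" "y < 1" "e_crit (Suc k) = y * e_crit k"
      "a_crit (Suc k) = 2 - y * (2 + a_crit k)"
      using e_crit_Suc[OF k e] by (elim exE conjE) (rule that)
    show ?thesis
      unfolding crit_values[OF True]
      using y e by (simp add: ln_div ln_mult del: a_crit.simps e_crit.simps)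
  next
    case False
    hence q: "q > 1" using q_cases by blast
    have d: "0 < a_super P k" "a_super P k \<le> 2" "0 < d_super P k"
      using super_bounds[of P k] P_conjugate(2)[OF q] by auto
    obtain y where y: "0 < y" "y < 1" "d_super P (Suc k) = y * d_super P k"
      "a_super P (Suc k) = 2 - y powr (P - 1) * (2 + a_super P k)"
      using d_super_Suc[OF k d P_conjugate(2)[OF q]] by (elim exE conjE) (rule that)
    show ?thesis
      unfolding super_values[OF q] using y d P_conjugate(2)[OF q]
      by (simp add: powr_mult del: a_super.simps d_super.simps)
  qed
  thus "a (Suc k) = 2 - G (Suc k) / G k * (2 + a k)" "c k < c (Suc k)" by auto
qed

lemma a_1: "a 1 = 2"
  by (simp add: a_seq_def)

lemma c_pos: "k \<ge> 2 \<Longrightarrow> c k > 0"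
  using c_Suc[of "k - 1"] c_nonneg[of "k - 1"] by (simp add: Suc_leI)

subsection \<open>The solutions\<close>

abbreviation u' :: "nat \<Rightarrow> real \<Rightarrow> real" where "u' n \<equiv> deriv_on {0..1} (u n)"

definition V :: "nat \<Rightarrow> real \<Rightarrow> real" where "V n x = - x * u' n x"

lemma lam_pos: "lam n > 0"
  using sol unfolding solution_seq_def Let_def by blast

lemma u_0: "u n 0 = mu n"
  using sol unfolding solution_seq_def Let_def by blast

lemma u_cont: "continuous_on {0..1} (u n)"
  using sol unfolding solution_seq_def Let_def C2_on_def C1_on_def
  by (auto intro: differentiable_imp_continuous_on)

lemma u_deriv: "0 < x \<Longrightarrow> x < 1 \<Longrightarrow> (u n has_real_derivative u' n x) (at x)"
  using sol unfolding solution_seq_def Let_def C2_on_def C1_on_def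
  by (auto intro!: deriv_on_DERIV)

lemma V_cont: "continuous_on {0..1} (V n)"
  using sol unfolding solution_seq_def Let_def C2_on_def C1_on_def V_def[abs_def]
  by (intro continuous_intros) auto

text \<open>Multiplying the radial equation by \<open>x\<close> puts it in divergence form, with
  \<open>V\<close> as flux.\<close>

lemma V_deriv:
  assumes "0 < x" "x < 1"
  shows "(V n has_real_derivative lam n * h x * f (u n x) * x) (at x)"
    and "0 \<le> lam n * h x * f (u n x) * x"
proof -
  have "(u' n has_real_derivative deriv_on {0..1} (u' n) x) (at x)"
    using sol assms unfolding solution_seq_def Let_def C2_on_def C1_on_def
    by (auto intro!: deriv_on_DERIV)
  hence *: "(V n has_real_derivative (- 1 * u' n x + deriv_on {0..1} (u' n) x * - x)) (at x)"
    unfolding V_def[abs_def] by (intro DERIV_mult) (auto intro!: derivative_eq_intros)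
  have ode: "- deriv_on {0..1} (u' n) x - 1 / x * u' n x = lam n * h x * f (u n x)" and "u n x > 0"
    using sol assms unfolding solution_seq_def Let_def by auto
  have "- 1 * u' n x + deriv_on {0..1} (u' n) x * - x = lam n * h x * f (u n x) * x"
    unfolding ode[symmetric] using assms by (simp add: field_simps)
  thus "(V n has_real_derivative lam n * h x * f (u n x) * x) (at x)"
    using * by simp
  have "h x > 0" "f (u n x) \<ge> 0"
    using nonlin assms \<open>u n x > 0\<close> unfolding nonlinearity_def by auto
  thus "0 \<le> lam n * h x * f (u n x) * x"
    using lam_pos[of n] assms by simp
qed

lemma V_mono:
  assumes "0 \<le> x" "x \<le> y" "y \<le> 1"
  shows "V n x \<le> V n y"
proof (rule DERIV_nonneg_imp_increasing_open[OF assms(2)])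
  show "\<exists>d. (V n has_real_derivative d) (at z) \<and> 0 \<le> d" if "x < z" "z < y" for z
    using V_deriv[of z n] that assms by (intro exI[of _ "lam n * h z * f (u n z) * z"]) auto
  show "continuous_on {x..y} (V n)"
    using V_cont by (rule continuous_on_subset) (use assms in auto)
qed

lemma u_antimono:
  assumes "0 \<le> x" "x \<le> y" "y \<le> 1"
  shows "u n y \<le> u n x"
proof (rule DERIV_nonpos_imp_decreasing_open[OF assms(2)])
  show "\<exists>d. (u n has_real_derivative d) (at z) \<and> d \<le> 0" if "x < z" "z < y" for z
  proof (intro exI conjI)
    show "(u n has_real_derivative u' n z) (at z)"
      using that assms by (intro u_deriv) auto
    \<comment> \<open>The flux vanishes at the centre and is nondecreasing, hence
      nonnegative.\<close>
    have "V n 0 \<le> V n z" using that assms by (intro V_mono) auto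
    thus "u' n z \<le> 0"
      using that assms by (auto simp: V_def mult_le_0_iff)
  qed
  show "continuous_on {x..y} (u n)"
    using u_cont by (rule continuous_on_subset) (use assms in auto)
qed

lemma integral_V:
  assumes "0 \<le> x" "x \<le> y" "y \<le> 1"
  shows "integral {x..y} (\<lambda>s. lam n * h s * f (u n s) * s) = V n y - V n x"
proof (rule integral_unique, rule fundamental_theorem_of_calculus_interior[OF assms(2)])
  show "continuous_on {x..y} (V n)"
    using V_cont by (rule continuous_on_subset) (use assms in auto)
  show "(V n has_vector_derivative lam n * h s * f (u n s) * s) (at s)" if "s \<in> {x<..<y}" for s
    using V_deriv(1)[of s n] that assms
    by (auto simp: has_real_derivative_iff_has_vector_derivative)
qed

text \<open>In the variable \<open>ln x\<close> the derivative of \<open>u n\<close> is minus the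
  flux, so Cauchy's theorem against \<open>ln\<close> produces \<open>V\<close>.\<close>

lemma log_mvt:
  assumes "0 < x" "x \<le> y" "y < 1"
  shows "\<exists>z\<in>{x..y}. u n x - u n y = V n z * (ln y - ln x)"
proof (cases "x = y")
  case False
  have "\<exists>z. x < z \<and> z < y \<and> (u n y - u n x) * (1 / z) = (ln y - ln x) * u' n z"
    using assms False
    by (intro GMVT') (auto intro!: derivative_eq_intros u_deriv DERIV_isCont[OF u_deriv] isCont_ln)
  then obtain z where z: "x < z" "z < y" "(u n y - u n x) * (1 / z) = (ln y - ln x) * u' n z"
    by blast
  hence "u n x - u n y = V n z * (ln y - ln x)"
    using assms by (simp add: V_def field_simps)
  thus ?thesis using z by (intro bexI[of _ z]) auto
qed (use assms in auto)

subsection \<open>The levels\<close>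

lemma w_mu_pos: "\<forall>\<^sub>F n in sequentially. mu n > 0 \<and> g (mu n) > 0 \<and> g' (mu n) > 0 \<and> w (mu n) > 0"
  using eventually_compose_filterlim[OF eventually_pos mu_top]
  by eventually_elim (use g'_pos in \<open>auto simp: w_def\<close>)

lemma g_mu_top: "filterlim (\<lambda>n. g (mu n)) at_top sequentially"
  by (rule filterlim_compose[OF g_at_top mu_top])

text \<open>A change of gauge: \<open>w (mu n) / mu n\<close> tends to \<open>1 - 1 / q\<close>,
  which is \<open>1 / P\<close>.\<close>

lemma super_level:
  assumes q: "q > 1" and lim: "(\<lambda>n. t n / mu n) \<longlonglongrightarrow> d"
  shows "(\<lambda>n. (mu n - t n) / w (mu n)) \<longlonglongrightarrow> P * (1 - d)"
proof -
  have "(\<lambda>n. (1 - t n / mu n) / (w (mu n) / mu n)) \<longlonglongrightarrow> (1 - d) / (1 - 1 / q)"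
    using q by (intro tendsto_intros lim filterlim_compose[OF w_over_id mu_top]) auto
  moreover have "(1 - d) / (1 - 1 / q) = P * (1 - d)"
    using P_conjugate(1)[OF q] q by (simp add: field_simps)
  moreover have "\<forall>\<^sub>F n in sequentially. (1 - t n / mu n) / (w (mu n) / mu n) = (mu n - t n) / w (mu n)"
    using w_mu_pos by eventually_elim (simp add: field_simps)
  ultimately show ?thesis
    by (auto intro: Lim_transform_eventually)
qed

lemma crit_level:
  assumes "eq_coeff (\<lambda>n. mu n - t n) x (\<lambda>n. g (mu n) / g' (mu n))"
  shows "(\<lambda>n. (mu n - t n) / w (mu n)) \<longlonglongrightarrow> x"
proof -
  have "\<forall>\<^sub>F n in sequentially. g (mu n) / g' (mu n) \<noteq> 0"
    using w_mu_pos by eventually_elim auto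
  from eq_coeff_tendsto[OF assms this] show ?thesis by (simp add: w_def)
qed

text \<open>The drop from the maximum \<open>mu n\<close> in units of \<open>w (mu n)\<close>, a
  scale that serves q = 1 and q > 1 alike.\<close>

definition level :: "real \<Rightarrow> (nat \<Rightarrow> real) \<Rightarrow> bool" where
  "level x s \<longleftrightarrow> (\<lambda>n. (mu n - u n (s n)) / w (mu n)) \<longlonglongrightarrow> x"

lemma at_level_imp:
  assumes "at_level f t0 q P mu u k s"
  shows "level (c k) s"
proof (cases "q = 1")
  case True
  thus ?thesis
    using assms crit_level[of "\<lambda>n. u n (s n)"]
    unfolding at_level_def Let_def level_def crit_values[OF True] by blast
next
  case False
  thus ?thesis
    using assms super_level[of "\<lambda>n. u n (s n)" "d_super P k"] q_cases super_values
    unfolding at_level_def Let_def level_def by (simp add: delta_seq_def)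
qed

text \<open>For q = 1 this is \<open>gamma_variation\<close> with
  \<open>exp (- c k) = e_crit k\<close>; for q > 1 the level is converted back into the limit
  \<open>d_super P k\<close> of \<open>u n (s n) / mu n\<close>, and
  \<open>regular_variation\<close> applies.\<close>

lemma
  assumes s: "level (c k) s"
  shows level_top: "filterlim (\<lambda>n. u n (s n)) at_top sequentially"
    and level_g: "(\<lambda>n. g (u n (s n)) / g (mu n)) \<longlonglongrightarrow> \<eta> k"
    and level_g': "(\<lambda>n. g' (u n (s n)) / g' (mu n)) \<longlonglongrightarrow> G k"
proof -
  have "filterlim (\<lambda>n. u n (s n)) at_top sequentially \<and>
    (\<lambda>n. g (u n (s n)) / g (mu n)) \<longlonglongrightarrow> \<eta> k \<and> (\<lambda>n. g' (u n (s n)) / g' (mu n)) \<longlonglongrightarrow> G k"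
  proof (cases "q = 1")
    case True
    hence "exp (- c k) = e_crit k"
      using crit_bounds[of k] unfolding crit_values[OF True] by (simp add: ln_div)
    thus ?thesis
      using gamma_variation[OF True mu_top s[unfolded level_def]] unfolding crit_values[OF True] by simp
  next
    case False
    hence q: "q > 1" using q_cases by blast
    have "(\<lambda>n. 1 - (mu n - u n (s n)) / w (mu n) * (w (mu n) / mu n)) \<longlonglongrightarrow> 1 - c k * (1 - 1 / q)"
      using s[unfolded level_def] by (intro tendsto_intros filterlim_compose[OF w_over_id mu_top])
    moreover have "P * (1 - 1 / q) = 1"
      using q P_conjugate(1)[OF q] by (simp add: field_simps)
    hence "1 - c k * (1 - 1 / q) = d_super P k"
      unfolding super_values[OF q] by (simp add: mult.commute[of P] mult.assoc)
    moreover have "\<forall>\<^sub>F n in sequentially.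
        1 - (mu n - u n (s n)) / w (mu n) * (w (mu n) / mu n) = u n (s n) / mu n"
      using w_mu_pos by eventually_elim (simp add: field_simps)
    ultimately have "(\<lambda>n. u n (s n) / mu n) \<longlonglongrightarrow> d_super P k"
      by (auto intro: Lim_transform_eventually)
    from regular_variation[OF q P_conjugate(1)[OF q] mu_top this] show ?thesis
      unfolding super_values[OF q] using super_bounds[of P k] P_conjugate(2)[OF q] by simp
  qed
  thus "filterlim (\<lambda>n. u n (s n)) at_top sequentially"
    "(\<lambda>n. g (u n (s n)) / g (mu n)) \<longlonglongrightarrow> \<eta> k" "(\<lambda>n. g' (u n (s n)) / g' (mu n)) \<longlonglongrightarrow> G k"
    by auto
qed

lemmas conc_k = conc[unfolded concentration_seqs_def Let_def, THEN conjunct2, THEN spec, THEN mp]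

lemma \<sigma>_1: "\<sigma> 1 n = 0"
  using conc unfolding concentration_seqs_def Let_def by blast

lemma
  assumes "k \<ge> 1"
  shows \<gamma>_pos: "\<gamma> k n > 0"
    and \<rho>_range: "\<rho> k n \<in> {0..<1}" and \<sigma>_range: "\<sigma> k n \<in> {0..<1}"
    and level_r: "level (c k) (r k)" and level_\<rho>: "level (c k) (\<rho> k)" and level_\<sigma>: "level (c k) (\<sigma> k)"
  using conc_k[OF assms] by (auto intro: at_level_imp)

lemma
  assumes "k \<ge> 1"
  shows \<rho>_lim: "\<rho> k \<longlonglongrightarrow> 0"
    and \<sigma>_\<gamma>: "(\<lambda>n. \<sigma> k n / \<gamma> k n) \<longlonglongrightarrow> 0"
    and \<rho>_\<gamma>: "filterlim (\<lambda>n. \<rho> k n / \<gamma> k n) at_top sequentially"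
    and mass: "(\<lambda>n. g' (u n (r k n)) * integral {\<sigma> k n..\<rho> k n} (\<lambda>x. lam n * h x * f (u n x) * x))
          \<longlonglongrightarrow> 2 * a k"
    and gap_mass: "(\<lambda>n. g' (mu n) * integral {\<rho> k n..\<sigma> (Suc k) n} (\<lambda>x. lam n * h x * f (u n x) * x))
          \<longlonglongrightarrow> 0"
    and ln_lam: "q > 1 \<or> (q = 1 \<and> inf_quot_pos f) \<longrightarrow> (\<lambda>n. ln (1 / lam n) / g (mu n)) \<longlonglongrightarrow> 0"
    and ln_\<rho>_\<gamma>: "(\<lambda>n. ln (\<rho> k n / \<gamma> k n) / g (u n (r k n))) \<longlonglongrightarrow> 0"
    and ln_\<sigma>_\<gamma>: "k \<noteq> 1 \<longrightarrow> (\<lambda>n. ln (\<sigma> k n / \<gamma> k n) / g (u n (r k n))) \<longlonglongrightarrow> 0"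
    and profile_conv: "sup_vanishes (\<lambda>n. {\<sigma> k n / \<gamma> k n..\<rho> k n / \<gamma> k n} \<inter> {0<..})
          (\<lambda>n x. (\<gamma> k n * x)\<^sup>2 * lam n * h (\<gamma> k n * x) * deriv_on {0..} f (u n (\<gamma> k n * x))
                   / (x\<^sup>2 * exp (limit_profile q P k x)) - 1)"
  using conc_k[OF assms] by simp_all

lemma \<sigma>_less_\<rho>:
  assumes "k \<ge> 1"
  shows "\<forall>\<^sub>F n in sequentially. \<sigma> k n < \<rho> k n \<and> 0 < \<rho> k n"
proof -
  have "\<forall>\<^sub>F n in sequentially. \<sigma> k n / \<gamma> k n < 1"
    using \<sigma>_\<gamma>[OF assms] by (rule order_tendstoD) simp
  moreover have "\<forall>\<^sub>F n in sequentially. \<rho> k n / \<gamma> k n > 1"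
    using \<rho>_\<gamma>[OF assms] by (simp add: filterlim_at_top_dense)
  ultimately show ?thesis
  proof eventually_elim
    case (elim n)
    have "\<gamma> k n > 0" by (rule \<gamma>_pos[OF assms])
    thus ?case using elim by (simp add: field_simps)
  qed
qed

text \<open>The order of neighbouring regions is recovered from their levels: \<open>m\<close>
  separates \<open>c k\<close> from \<open>c (Suc k)\<close>, so \<open>u n\<close> is larger at
  \<open>\<rho> k n\<close>, and \<open>u n\<close> is nonincreasing.\<close>

lemma \<rho>_less_\<sigma>_Suc:
  assumes "k \<ge> 1"
  shows "\<forall>\<^sub>F n in sequentially. \<rho> k n < \<sigma> (Suc k) n"
proof -
  define m where "m = (c k + c (Suc k)) / 2"
  have m: "c k < m" "m < c (Suc k)" using c_Suc[OF assms] by (auto simp: m_def)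
  have "\<forall>\<^sub>F n in sequentially. (mu n - u n (\<rho> k n)) / w (mu n) < m"
    using level_\<rho>[OF assms, unfolded level_def] m(1) by (rule order_tendstoD)
  moreover have "\<forall>\<^sub>F n in sequentially. (mu n - u n (\<sigma> (Suc k) n)) / w (mu n) > m"
    using level_\<sigma>[of "Suc k", unfolded level_def] m(2) by (intro order_tendstoD(1)) auto
  ultimately show ?thesis using w_mu_pos
  proof eventually_elim
    case (elim n)
    have "(mu n - u n (\<rho> k n)) / w (mu n) < (mu n - u n (\<sigma> (Suc k) n)) / w (mu n)"
      using elim by linarith
    hence "u n (\<rho> k n) > u n (\<sigma> (Suc k) n)"
      using elim by (simp add: divide_strict_right_mono field_simps)
    thus ?case
      using u_antimono[of "\<sigma> (Suc k) n" "\<rho> k n" n] \<rho>_range[OF assms, of n] \<sigma>_range[of "Suc k" n]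
      by force
  qed
qed

text \<open>At the centre the drop is zero, whereas its limit \<open>c k\<close> along
  \<open>\<sigma> k\<close> is positive for \<open>k \<ge> 2\<close>.\<close>

lemma \<sigma>_pos:
  assumes "k \<ge> 2"
  shows "\<forall>\<^sub>F n in sequentially. \<sigma> k n > 0"
proof -
  have "\<forall>\<^sub>F n in sequentially. (mu n - u n (\<sigma> k n)) / w (mu n) > 0"
    using level_\<sigma>[of k, unfolded level_def] c_pos[OF assms] assms by (intro order_tendstoD(1)) auto
  thus ?thesis
  proof eventually_elim
    case (elim n)
    hence "\<sigma> k n \<noteq> 0" using u_0[of n] by auto
    thus ?case using \<sigma>_range[of k n] assms by auto
  qed
qed

lemma V_\<rho>:
  assumes "k \<ge> 1"
  shows "(\<lambda>n. g' (mu n) * V n (\<rho> k n)) \<longlonglongrightarrow> (2 + a k) / G k"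
    and "(\<lambda>n. g' (mu n) * V n (\<sigma> (Suc k) n)) \<longlonglongrightarrow> (2 + a k) / G k"
proof -
  \<comment> \<open>Crossing region \<open>k\<close> adds \<open>2 * a k / G k\<close> to the scaled
    flux; \<open>G k\<close> converts the normalisation by \<open>g' (u n (r k n))\<close> into that
    by \<open>g' (mu n)\<close>.\<close>
  have up: "(\<lambda>n. g' (mu n) * V n (\<rho> k n)) \<longlonglongrightarrow> (2 + a k) / G k"
    if k: "k \<ge> 1" and V: "(\<lambda>n. g' (mu n) * V n (\<sigma> k n)) \<longlonglongrightarrow> (2 - a k) / G k" for k
  proof -
    let ?I = "\<lambda>n. integral {\<sigma> k n..\<rho> k n} (\<lambda>x. lam n * h x * f (u n x) * x)"
    have "(\<lambda>n. g' (mu n) * V n (\<sigma> k n) + g' (u n (r k n)) * ?I n / (g' (u n (r k n)) / g' (mu n)))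
        \<longlonglongrightarrow> (2 - a k) / G k + 2 * a k / G k"
      using G_pos[of k] by (intro tendsto_intros V mass k level_g' level_r) auto
    moreover have "(2 - a k) / G k + 2 * a k / G k = (2 + a k) / G k"
      using G_pos[of k] by (simp add: field_simps)
    moreover have "\<forall>\<^sub>F n in sequentially. u n (r k n) > t0"
      using level_top[OF level_r[OF k]] by (simp add: filterlim_at_top_dense)
    hence "\<forall>\<^sub>F n in sequentially. g' (mu n) * V n (\<sigma> k n) +
        g' (u n (r k n)) * ?I n / (g' (u n (r k n)) / g' (mu n)) = g' (mu n) * V n (\<rho> k n)"
      using w_mu_pos \<sigma>_less_\<rho>[OF k]
    proof eventually_elim
      case (elim n)
      have I: "?I n = V n (\<rho> k n) - V n (\<sigma> k n)"
        using elim \<rho>_range[OF k, of n] \<sigma>_range[OF k, of n] by (intro integral_V) auto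
      show ?case unfolding I using elim g'_pos[of "u n (r k n)"] by (simp add: field_simps)
    qed
    ultimately show ?thesis
      by (auto intro: Lim_transform_eventually)
  qed
  have gap: "(\<lambda>n. g' (mu n) * V n (\<sigma> (Suc k) n)) \<longlonglongrightarrow> (2 + a k) / G k"
    if k: "k \<ge> 1" and V: "(\<lambda>n. g' (mu n) * V n (\<rho> k n)) \<longlonglongrightarrow> (2 + a k) / G k" for k
  proof -
    let ?I = "\<lambda>n. integral {\<rho> k n..\<sigma> (Suc k) n} (\<lambda>x. lam n * h x * f (u n x) * x)"
    have "(\<lambda>n. g' (mu n) * V n (\<rho> k n) + g' (mu n) * ?I n) \<longlonglongrightarrow> (2 + a k) / G k + 0"
      by (intro tendsto_intros V gap_mass k)
    moreover have "\<forall>\<^sub>F n in sequentially. g' (mu n) * V n (\<rho> k n) + g' (mu n) * ?I n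
        = g' (mu n) * V n (\<sigma> (Suc k) n)"
      using \<rho>_less_\<sigma>_Suc[OF k]
    proof eventually_elim
      case (elim n)
      have I: "?I n = V n (\<sigma> (Suc k) n) - V n (\<rho> k n)"
        using elim \<rho>_range[OF k, of n] \<sigma>_range[of "Suc k" n] by (intro integral_V) auto
      show ?case unfolding I by (simp add: algebra_simps)
    qed
    ultimately show ?thesis
      by (auto intro: Lim_transform_eventually)
  qed
  show "(\<lambda>n. g' (mu n) * V n (\<rho> k n)) \<longlonglongrightarrow> (2 + a k) / G k"
    using assms
  proof (induction k rule: dec_induct)
    case base
    \<comment> \<open>The flux at \<open>\<sigma> 1 n = 0\<close> vanishes, matching
      \<open>(2 - a 1) / G 1\<close> because \<open>a 1 = 2\<close>.\<close>
    show ?case by (rule up) (simp_all add: \<sigma>_1 V_def a_1 del: One_nat_def)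
  next
    case (step k)
    \<comment> \<open>The recursion for \<open>a\<close> says exactly that the flux leaving region
      \<open>k\<close> is the flux entering region \<open>k + 1\<close>.\<close>
    have "(2 + a k) / G k = (2 - a (Suc k)) / G (Suc k)"
      using a_Suc[of k] step.hyps G_pos[of k] G_pos[of "Suc k"] by (simp add: field_simps)
    thus ?case using gap[of k] step by (intro up) auto
  qed
  from gap[OF assms this] show "(\<lambda>n. g' (mu n) * V n (\<sigma> (Suc k) n)) \<longlonglongrightarrow> (2 + a k) / G k" .
qed

subsection \<open>Inside a concentration region\<close>

text \<open>\<open>R\<^sup>2\<close> times the exponential of the limit profile, with the power
  \<open>R powr (2 - a k)\<close> cancelled.\<close>

definition Q :: "nat \<Rightarrow> real \<Rightarrow> real" where
  "Q k R = 2 * (a k)\<^sup>2 * b k * R powr a k / (1 + b k * R powr a k)\<^sup>2"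

lemma Q_pos: "R > 0 \<Longrightarrow> Q k R > 0"
  unfolding Q_def using a_pos[of k] b_pos[of k] add_pos_nonneg[of 1 "b k * R powr a k"]
  by (intro divide_pos_pos mult_pos_pos zero_less_power) auto

lemma profile_Q:
  assumes "R > 0"
  shows "R\<^sup>2 * exp (limit_profile q P k R) = Q k R"
proof -
  \<comment> \<open>As \<open>R > 0\<close>, both branches have the value
    \<open>R powr (2 - a k)\<close>; the split matters at \<open>R = 0\<close>, where
    \<open>0 powr 0 = 0\<close>.\<close>
  define D where "D = (if a k = 2 then 1 else R powr (2 - a k))"
  have D: "D > 0" "R\<^sup>2 / D = R powr a k"
    using assms by (auto simp: D_def powr_diff)
  have pos: "1 + b k * R powr a k > 0"
    using b_pos[of k] by (simp add: add_pos_nonneg)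
  hence "exp (limit_profile q P k R) = 2 * (a k)\<^sup>2 * b k / (D * (1 + b k * R powr a k)\<^sup>2)"
    unfolding limit_profile_def Let_def D_def[symmetric] using D a_pos[of k] b_pos[of k]
    by (intro exp_ln divide_pos_pos mult_pos_pos) auto
  thus ?thesis
    using D pos unfolding Q_def D(2)[symmetric] by (simp add: field_simps)
qed

lemma h_facts: "h 0 > 0" "x \<in> {0..1} \<Longrightarrow> h x > 0" "continuous_on {0..1} h"
  using nonlin unfolding nonlinearity_def C1_on_def
  by (auto intro: differentiable_imp_continuous_on)

lemma ln_scaled:
  assumes "x > 0"
  shows "ln (1 / (sqrt (lam n) * x)) = ln (1 / lam n) / 2 - ln x"
  using assms lam_pos[of n] by (simp add: ln_div ln_mult ln_sqrt)

text \<open>Both ends of the region have level \<open>c k\<close>, and monotonicity of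
  \<open>u n\<close> squeezes every sequence between them.\<close>

lemma region_level:
  assumes k: "k \<ge> 1" and rn: "\<forall>\<^sub>F n in sequentially. rn n \<in> {\<sigma> k n..\<rho> k n}"
  shows "level (c k) rn"
  unfolding level_def
proof (rule tendsto_sandwich[OF _ _ level_\<sigma>[OF k, unfolded level_def] level_\<rho>[OF k, unfolded level_def]])
  have rng: "0 \<le> \<sigma> k n" "\<rho> k n \<le> 1" for n
    using \<rho>_range[OF k, of n] \<sigma>_range[OF k, of n] by auto
  show "\<forall>\<^sub>F n in sequentially. (mu n - u n (\<sigma> k n)) / w (mu n) \<le> (mu n - u n (rn n)) / w (mu n)"
    using rn w_mu_pos
  proof eventually_elim
    case (elim n)
    thus ?case
      using rng[of n] by (intro divide_right_mono diff_left_mono u_antimono) auto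
  qed
  show "\<forall>\<^sub>F n in sequentially. (mu n - u n (rn n)) / w (mu n) \<le> (mu n - u n (\<rho> k n)) / w (mu n)"
    using rn w_mu_pos
  proof eventually_elim
    case (elim n)
    thus ?case
      using rng[of n] by (intro divide_right_mono diff_left_mono u_antimono) auto
  qed
qed

lemma region_asymptotics:
  assumes k: "k \<ge> 1" and rn: "\<forall>\<^sub>F n in sequentially. rn n \<in> {\<sigma> k n..\<rho> k n} \<and> rn n > 0"
  shows "(\<lambda>n. g (u n (rn n)) + ln (g' (u n (rn n)))
    - (2 * ln (1 / (sqrt (lam n) * rn n)) + (ln (Q k (rn n / \<gamma> k n)) - ln (h 0)))) \<longlonglongrightarrow> 0"
proof -
  define R where "R n = rn n / \<gamma> k n" for n
  define X where "X n = (\<gamma> k n * R n)\<^sup>2 * lam n * h (\<gamma> k n * R n) * deriv_on {0..} f (u n (\<gamma> k n * R n))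
                   / ((R n)\<^sup>2 * exp (limit_profile q P k (R n)))" for n
  have \<gamma>: "\<gamma> k n > 0" for n by (rule \<gamma>_pos[OF k])
  have "\<forall>\<^sub>F n in sequentially. R n \<in> {\<sigma> k n / \<gamma> k n..\<rho> k n / \<gamma> k n} \<inter> {0<..}"
    using rn by eventually_elim (use \<gamma> in \<open>auto simp: R_def divide_right_mono less_imp_le\<close>)
  from sup_vanishesD[OF profile_conv[OF k] this] have "X \<longlonglongrightarrow> 1"
    unfolding X_def by (simp add: LIM_zero_iff)
  hence lnX: "(\<lambda>n. ln (X n)) \<longlonglongrightarrow> ln 1"
    by (rule tendsto_ln) simp
  have \<rho>1: "\<rho> k n \<le> 1" "0 \<le> \<sigma> k n" for n
    using \<rho>_range[OF k, of n] \<sigma>_range[OF k, of n] by auto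
  have rn01: "\<forall>\<^sub>F n in sequentially. rn n \<in> {0..1}"
    using rn by eventually_elim (use \<rho>1 order_trans in fastforce)
  have "rn \<longlonglongrightarrow> 0"
    using rn \<rho>_lim[OF k]
    by (intro tendsto_sandwich[of "\<lambda>_. 0" rn sequentially "\<rho> k"]) (auto elim: eventually_mono)
  hence "(\<lambda>n. h (rn n)) \<longlonglongrightarrow> h 0"
    by (intro continuous_on_tendsto_compose[OF h_facts(3)] rn01) auto
  hence lnh: "(\<lambda>n. ln (h (rn n))) \<longlonglongrightarrow> ln (h 0)"
    using h_facts(1) by (intro tendsto_ln) auto
  have "\<forall>\<^sub>F n in sequentially. rn n \<in> {\<sigma> k n..\<rho> k n}"
    using rn by eventually_elim auto
  from level_top[OF region_level[OF k this]] have "\<forall>\<^sub>F n in sequentially. u n (rn n) > t0"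
    by (simp add: filterlim_at_top_dense)
  \<comment> \<open>The identity f' = f g' splits the logarithm of f' into \<open>g\<close> plus
    \<open>ln g'\<close>; the profile contributes \<open>ln Q\<close>, and \<open>h (rn n)\<close>
    is exchanged for its limit \<open>h 0\<close>.\<close>
  hence "\<forall>\<^sub>F n in sequentially. ln (X n) - ln (h (rn n)) + ln (h 0) =
    g (u n (rn n)) + ln (g' (u n (rn n)))
    - (2 * ln (1 / (sqrt (lam n) * rn n)) + (ln (Q k (rn n / \<gamma> k n)) - ln (h 0)))"
    using rn rn01
  proof eventually_elim
    case (elim n)
    have R: "R n > 0" "\<gamma> k n * R n = rn n" using elim \<gamma>[of n] by (auto simp: R_def)
    have pos: "h (rn n) > 0" "f (u n (rn n)) > 0" "g' (u n (rn n)) > 0" "Q k (R n) > 0" "lam n > 0"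
      using h_facts(2) elim f_facts(1) g'_pos Q_pos R lam_pos by auto
    have "X n = (rn n)\<^sup>2 * lam n * h (rn n) * (f (u n (rn n)) * g' (u n (rn n))) / Q k (R n)"
      unfolding X_def R(2) profile_Q[OF R(1)] using elim by (simp add: deriv_f_eq)
    hence "ln (X n) = 2 * ln (rn n) + ln (lam n) + ln (h (rn n)) + (g (u n (rn n)) + ln (g' (u n (rn n))))
        - ln (Q k (R n))"
      using pos elim by (simp add: ln_mult ln_div ln_realpow log_f_def)
    moreover have "2 * ln (1 / (sqrt (lam n) * rn n)) = - ln (lam n) - 2 * ln (rn n)"
      using elim pos ln_scaled[of "rn n" n] by (simp add: ln_div)
    ultimately show ?case by (simp add: R_def)
  qed
  moreover have "(\<lambda>n. ln (X n) - ln (h (rn n)) + ln (h 0)) \<longlonglongrightarrow> ln 1 - ln (h 0) + ln (h 0)"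
    by (intro tendsto_intros lnX lnh)
  ultimately show ?thesis
    by (auto intro: Lim_transform_eventually)
qed

text \<open>Up to constants \<open>Q\<close> lies between powers of \<open>R\<close>, so
  \<open>\<bar>ln Q\<bar>\<close> is at most a constant plus a multiple of
  \<open>\<bar>ln R\<bar>\<close>.\<close>

lemma ln_Q_negligible:
  assumes R: "\<forall>\<^sub>F n in sequentially. R n > 0" and lnR: "(\<lambda>n. ln (R n) / g (mu n)) \<longlonglongrightarrow> 0"
  shows "(\<lambda>n. ln (Q k (R n)) / g (mu n)) \<longlonglongrightarrow> 0"
proof -
  let ?L = "\<lambda>n. ln (1 + b k * R n powr a k)"
  have inv: "(\<lambda>n. C / g (mu n)) \<longlonglongrightarrow> 0" for C
    by (rule real_tendsto_divide_at_top[OF tendsto_const g_mu_top])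
  have "(\<lambda>n. ln (1 + b k) / g (mu n) + a k * \<bar>ln (R n) / g (mu n)\<bar>) \<longlonglongrightarrow> 0 + a k * \<bar>0\<bar>"
    by (intro tendsto_intros inv lnR)
  hence bound: "(\<lambda>n. ln (1 + b k) / g (mu n) + a k * \<bar>ln (R n) / g (mu n)\<bar>) \<longlonglongrightarrow> 0"
    by simp
  have L: "(\<lambda>n. ?L n / g (mu n)) \<longlonglongrightarrow> 0"
  proof (rule Lim_null_comparison[OF _ bound])
    show "\<forall>\<^sub>F n in sequentially. norm (?L n / g (mu n)) \<le> ln (1 + b k) / g (mu n) + a k * \<bar>ln (R n) / g (mu n)\<bar>"
      using R w_mu_pos
    proof eventually_elim
      case (elim n)
      \<comment> \<open>\<open>E\<close> dominates \<open>R n powr a k\<close> on either side of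
        \<open>R n = 1\<close> and is at least 1, so it also absorbs the summand 1.\<close>
      define E where "E = exp (a k * \<bar>ln (R n)\<bar>)"
      have "E \<ge> 1" using a_pos[of k] by (simp add: E_def)
      have "R n powr a k = exp (a k * ln (R n))"
        using elim by (simp add: powr_def)
      also have "\<dots> \<le> E"
        using a_pos[of k] by (auto simp: E_def intro!: mult_left_mono)
      finally have RE: "R n powr a k \<le> E" .
      have "1 + b k * R n powr a k \<le> E + b k * E"
        using RE \<open>E \<ge> 1\<close> b_pos[of k] by (intro add_mono mult_left_mono) auto
      also have "\<dots> = (1 + b k) * E" by (simp add: algebra_simps)
      finally have "?L n \<le> ln ((1 + b k) * E)"
        using b_pos[of k] \<open>E \<ge> 1\<close> by (subst ln_le_cancel_iff) (auto simp: add_pos_nonneg)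
      also have "\<dots> = ln (1 + b k) + a k * \<bar>ln (R n)\<bar>"
        using b_pos[of k] \<open>E \<ge> 1\<close> by (simp add: ln_mult E_def)
      finally have "?L n \<le> ln (1 + b k) + a k * \<bar>ln (R n)\<bar>" .
      hence "?L n / g (mu n) \<le> (ln (1 + b k) + a k * \<bar>ln (R n)\<bar>) / g (mu n)"
        using elim by (intro divide_right_mono) auto
      moreover have "?L n \<ge> 0" using b_pos[of k] by (intro ln_ge_zero) auto
      ultimately show ?case using elim by (simp add: add_divide_distrib)
    qed
  qed
  have "(\<lambda>n. ln (2 * (a k)\<^sup>2 * b k) / g (mu n) + a k * (ln (R n) / g (mu n)) - 2 * (?L n / g (mu n)))
      \<longlonglongrightarrow> 0 + a k * 0 - 2 * 0"
    by (intro tendsto_intros inv lnR L)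
  moreover have "\<forall>\<^sub>F n in sequentially.
      ln (2 * (a k)\<^sup>2 * b k) / g (mu n) + a k * (ln (R n) / g (mu n)) - 2 * (?L n / g (mu n))
      = ln (Q k (R n)) / g (mu n)"
    using R
  proof eventually_elim
    case (elim n)
    have "1 + b k * R n powr a k > 0" using b_pos[of k] by (simp add: add_pos_nonneg)
    moreover have "2 * (a k)\<^sup>2 * b k > 0" using a_pos[of k] b_pos[of k] by simp
    moreover have "R n powr a k > 0" using elim by simp
    ultimately have "ln (Q k (R n)) = ln (2 * (a k)\<^sup>2 * b k) + ln (R n powr a k) - ln ((1 + b k * R n powr a k)\<^sup>2)"
      unfolding Q_def by (simp only: ln_divide_pos ln_mult_pos mult_pos_pos zero_less_power)
    also have "\<dots> = ln (2 * (a k)\<^sup>2 * b k) + a k * ln (R n) - 2 * ?L n"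
      using \<open>1 + b k * R n powr a k > 0\<close> elim by (simp add: ln_realpow ln_powr)
    finally show ?case by (simp add: add_divide_distrib diff_divide_distrib)
  qed
  ultimately show ?thesis
    by (auto intro: Lim_transform_eventually)
qed

text \<open>\<open>region_asymptotics\<close> divided by \<open>g (mu n)\<close>: the terms in
  \<open>ln g'\<close>, \<open>ln Q\<close> and \<open>ln (h 0)\<close> are negligible, so twice the
  logarithm inherits the limit \<open>\<eta> k\<close> of
  \<open>g (u n (rn n)) / g (mu n)\<close>.\<close>

lemma region_scale:
  assumes k: "k \<ge> 1" and rn: "\<forall>\<^sub>F n in sequentially. rn n \<in> {\<sigma> k n..\<rho> k n} \<and> rn n > 0"
    and lnR: "(\<lambda>n. ln (rn n / \<gamma> k n) / g (mu n)) \<longlonglongrightarrow> 0"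
  shows "(\<lambda>n. ln (1 / (sqrt (lam n) * rn n)) / g (mu n)) \<longlonglongrightarrow> \<eta> k / 2"
proof -
  define E where "E n = g (u n (rn n)) + ln (g' (u n (rn n)))
    - (2 * ln (1 / (sqrt (lam n) * rn n)) + (ln (Q k (rn n / \<gamma> k n)) - ln (h 0)))" for n
  have "E \<longlonglongrightarrow> 0"
    unfolding E_def using region_asymptotics[OF k rn] .
  have E: "(\<lambda>n. E n / g (mu n)) \<longlonglongrightarrow> 0" and C: "(\<lambda>n. ln (h 0) / g (mu n)) \<longlonglongrightarrow> 0"
    by (rule real_tendsto_divide_at_top[OF _ g_mu_top], fact | rule real_tendsto_divide_at_top[OF tendsto_const g_mu_top])+
  have "\<forall>\<^sub>F n in sequentially. rn n \<in> {\<sigma> k n..\<rho> k n}"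
    using rn by eventually_elim auto
  note lev = region_level[OF k this]
  have Qlim: "(\<lambda>n. ln (Q k (rn n / \<gamma> k n)) / g (mu n)) \<longlonglongrightarrow> 0"
    using rn \<gamma>_pos[OF k] by (intro ln_Q_negligible lnR) (auto elim: eventually_mono)
  have g'lim: "(\<lambda>n. ln (g' (u n (rn n))) / g (u n (rn n))) \<longlonglongrightarrow> 0"
    by (rule filterlim_compose[OF ln_g'_over_g level_top[OF lev]])
  have "(\<lambda>n. (g (u n (rn n)) / g (mu n) + ln (g' (u n (rn n))) / g (u n (rn n)) * (g (u n (rn n)) / g (mu n))
      - ln (Q k (rn n / \<gamma> k n)) / g (mu n) + ln (h 0) / g (mu n) - E n / g (mu n)) / 2)
      \<longlonglongrightarrow> (\<eta> k + 0 * \<eta> k - 0 + 0 - 0) / 2"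
    by (intro tendsto_intros level_g[OF lev] g'lim Qlim C E) auto
  moreover have "\<forall>\<^sub>F n in sequentially. g (u n (rn n)) > 0"
    using filterlim_compose[OF g_at_top level_top[OF lev]] by (simp add: filterlim_at_top_dense)
  hence "\<forall>\<^sub>F n in sequentially.
      (g (u n (rn n)) / g (mu n) + ln (g' (u n (rn n))) / g (u n (rn n)) * (g (u n (rn n)) / g (mu n))
      - ln (Q k (rn n / \<gamma> k n)) / g (mu n) + ln (h 0) / g (mu n) - E n / g (mu n)) / 2
      = ln (1 / (sqrt (lam n) * rn n)) / g (mu n)"
  proof eventually_elim
    case (elim n)
    hence "ln (g' (u n (rn n))) / g (u n (rn n)) * (g (u n (rn n)) / g (mu n)) = ln (g' (u n (rn n))) / g (mu n)"
      by simp
    moreover have "2 * ln (1 / (sqrt (lam n) * rn n)) =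
        g (u n (rn n)) + ln (g' (u n (rn n))) - ln (Q k (rn n / \<gamma> k n)) + ln (h 0) - E n"
      by (simp add: E_def)
    hence "ln (1 / (sqrt (lam n) * rn n)) =
        (g (u n (rn n)) + ln (g' (u n (rn n))) - ln (Q k (rn n / \<gamma> k n)) + ln (h 0) - E n) / 2"
      by (metis nonzero_mult_div_cancel_left zero_neq_numeral)
    ultimately show ?case by (simp only: add_divide_distrib diff_divide_distrib) (simp add: mult.commute)
  qed
  ultimately show ?thesis
    by (auto intro: Lim_transform_eventually)
qed

text \<open>Under the first assumption \<open>ln (lam n)\<close> is negligible against
  \<open>g (mu n)\<close>.\<close>

lemma drop_lam:
  assumes "q > 1 \<or> (q = 1 \<and> inf_quot_pos f)" "\<forall>\<^sub>F n in sequentially. rn n > 0"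
    and lim: "(\<lambda>n. ln (1 / (sqrt (lam n) * rn n)) / g (mu n)) \<longlonglongrightarrow> x"
  shows "(\<lambda>n. ln (1 / rn n) / g (mu n)) \<longlonglongrightarrow> x"
proof -
  have "(\<lambda>n. ln (1 / lam n) / g (mu n)) \<longlonglongrightarrow> 0"
    using ln_lam[of 1] assms(1) by simp
  hence "(\<lambda>n. ln (1 / (sqrt (lam n) * rn n)) / g (mu n) - ln (1 / lam n) / g (mu n) / 2) \<longlonglongrightarrow> x - 0 / 2"
    by (intro tendsto_intros lim) auto
  moreover have "\<forall>\<^sub>F n in sequentially.
      ln (1 / (sqrt (lam n) * rn n)) / g (mu n) - ln (1 / lam n) / g (mu n) / 2 = ln (1 / rn n) / g (mu n)"
    using assms(2)
  proof eventually_elim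
    case (elim n)
    hence "ln (1 / rn n) = - ln (rn n)" by (simp add: ln_div)
    thus ?case
      unfolding ln_scaled[OF elim] by (simp only: diff_divide_distrib) simp
  qed
  ultimately show ?thesis
    by (auto intro: Lim_transform_eventually)
qed

lemma scaled_by_r:
  assumes k: "k \<ge> 1" and lim: "(\<lambda>n. X n / g (u n (r k n))) \<longlonglongrightarrow> 0"
  shows "(\<lambda>n. X n / g (mu n)) \<longlonglongrightarrow> 0"
proof -
  have "(\<lambda>n. X n / g (u n (r k n)) * (g (u n (r k n)) / g (mu n))) \<longlonglongrightarrow> 0 * \<eta> k"
    by (intro tendsto_intros lim level_g level_r k)
  moreover have "\<forall>\<^sub>F n in sequentially. g (u n (r k n)) > 0"
    using filterlim_compose[OF g_at_top level_top[OF level_r[OF k]]] by (simp add: filterlim_at_top_dense)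
  hence "\<forall>\<^sub>F n in sequentially. X n / g (u n (r k n)) * (g (u n (r k n)) / g (mu n)) = X n / g (mu n)"
    by eventually_elim simp
  ultimately show ?thesis
    by (auto intro: Lim_transform_eventually)
qed

lemma region_eq_coeff:
  assumes k: "k \<ge> 1" and rn: "\<forall>n. rn n \<in> {\<sigma> k n..\<rho> k n} \<and> rn n > 0"
    and k1: "k = 1 \<longrightarrow> (\<lambda>n. ln (rn n / \<gamma> k n) / g (mu n)) \<longlonglongrightarrow> 0"
    and q: "q = 1 \<longrightarrow> inf_quot_pos f"
  shows "eq_coeff (\<lambda>n. g (u n (rn n))) 2 (\<lambda>n. ln (1 / rn n))"
proof -
  \<comment> \<open>For \<open>k \<ge> 2\<close> this logarithm lies between those at the two
    endpoints, both negligible. For \<open>k = 1\<close> the lower endpoint is 0, and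
    \<open>k1\<close> takes the place of this bound.\<close>
  have lnR: "(\<lambda>n. ln (rn n / \<gamma> k n) / g (mu n)) \<longlonglongrightarrow> 0"
  proof (cases "k = 1")
    case False
    let ?S = "\<lambda>n. \<bar>ln (\<sigma> k n / \<gamma> k n) / g (mu n)\<bar> + \<bar>ln (\<rho> k n / \<gamma> k n) / g (mu n)\<bar>"
    have "?S \<longlonglongrightarrow> \<bar>0\<bar> + \<bar>0\<bar>"
      using ln_\<sigma>_\<gamma>[OF k] ln_\<rho>_\<gamma>[OF k] False by (intro tendsto_intros scaled_by_r[OF k]) auto
    hence S: "?S \<longlonglongrightarrow> 0" by simp
    show ?thesis
    proof (rule Lim_null_comparison[OF _ S])
      have "k \<ge> 2" using k False by simp
      show "\<forall>\<^sub>F n in sequentially. norm (ln (rn n / \<gamma> k n) / g (mu n)) \<le> ?S n"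
        using \<sigma>_pos[OF \<open>k \<ge> 2\<close>] w_mu_pos
      proof eventually_elim
        case (elim n)
        have pos: "\<sigma> k n / \<gamma> k n > 0" using elim \<gamma>_pos[OF k] by simp
        have le: "\<sigma> k n / \<gamma> k n \<le> rn n / \<gamma> k n" "rn n / \<gamma> k n \<le> \<rho> k n / \<gamma> k n"
          using rn \<gamma>_pos[OF k, of n] by (auto intro!: divide_right_mono)
        have "ln (\<sigma> k n / \<gamma> k n) \<le> ln (rn n / \<gamma> k n)" "ln (rn n / \<gamma> k n) \<le> ln (\<rho> k n / \<gamma> k n)"
          using pos le by (auto intro!: ln_mono)
        hence "\<bar>ln (rn n / \<gamma> k n)\<bar> \<le> \<bar>ln (\<sigma> k n / \<gamma> k n)\<bar> + \<bar>ln (\<rho> k n / \<gamma> k n)\<bar>"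
          by linarith
        hence "\<bar>ln (rn n / \<gamma> k n)\<bar> / g (mu n) \<le> (\<bar>ln (\<sigma> k n / \<gamma> k n)\<bar> + \<bar>ln (\<rho> k n / \<gamma> k n)\<bar>) / g (mu n)"
          using elim by (intro divide_right_mono) auto
        thus ?case using elim by (simp add: add_divide_distrib)
      qed
    qed
  qed (use k1 in simp)
  have ev: "\<forall>\<^sub>F n in sequentially. rn n \<in> {\<sigma> k n..\<rho> k n} \<and> rn n > 0"
    using rn by simp
  have "level (c k) rn"
    using rn by (intro region_level k) simp
  hence A: "(\<lambda>n. g (u n (rn n)) / g (mu n)) \<longlonglongrightarrow> \<eta> k" by (rule level_g)
  have "q > 1 \<or> (q = 1 \<and> inf_quot_pos f)" using q q_cases by blast
  moreover have "\<forall>\<^sub>F n in sequentially. rn n > 0" using rn by simp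
  ultimately have B: "(\<lambda>n. ln (1 / rn n) / g (mu n)) \<longlonglongrightarrow> \<eta> k / 2"
    using region_scale[OF k ev lnR] by (rule drop_lam)
  \<comment> \<open>The level cancels: the coefficient is \<open>\<eta> k / (\<eta> k / 2)\<close>,
    the same for every \<open>k\<close>.\<close>
  show ?thesis
  proof (rule eq_coeffI[OF A B])
    show "\<forall>\<^sub>F n in sequentially. g (mu n) \<noteq> 0"
      using w_mu_pos by eventually_elim auto
  qed (use eta_pos[of k] in simp_all)
qed

subsection \<open>Between two concentration regions\<close>

text \<open>At both ends of the gap the flux scaled by \<open>g' (mu n)\<close> has the same limit,
  so monotonicity fixes it in between. Then \<open>u n\<close> is affine in the logarithm to leading
  order, and \<open>(x - c k) * G k / (2 + a k)\<close> is the logarithmic distance from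
  \<open>\<rho> k n\<close>.\<close>

lemma gap_scale:
  assumes k: "k \<ge> 1" and rn: "\<forall>n. rn n \<in> {\<rho> k n..\<sigma> (Suc k) n}" and lev: "level x rn"
  shows "(\<lambda>n. ln (1 / (sqrt (lam n) * rn n)) / g (mu n)) \<longlonglongrightarrow> \<eta> k / 2 - (x - c k) * G k / (2 + a k)"
    and "\<forall>\<^sub>F n in sequentially. rn n > 0"
proof -
  have rng: "0 \<le> \<rho> k n" "\<sigma> (Suc k) n < 1" for n
    using \<rho>_range[OF k, of n] \<sigma>_range[of "Suc k" n] by auto
  have \<rho>pos: "\<forall>\<^sub>F n in sequentially. \<rho> k n > 0"
    using \<sigma>_less_\<rho>[OF k] by eventually_elim auto
  thus "\<forall>\<^sub>F n in sequentially. rn n > 0"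
    by eventually_elim (use rn less_le_trans in fastforce)
  have "\<forall>n. \<exists>z. \<rho> k n > 0 \<longrightarrow> z \<in> {\<rho> k n..rn n} \<and>
      u n (\<rho> k n) - u n (rn n) = V n z * (ln (rn n) - ln (\<rho> k n))"
  proof (intro allI)
    fix n
    show "\<exists>z. \<rho> k n > 0 \<longrightarrow> z \<in> {\<rho> k n..rn n} \<and>
      u n (\<rho> k n) - u n (rn n) = V n z * (ln (rn n) - ln (\<rho> k n))"
    proof (cases "\<rho> k n > 0")
      case True
      have "\<rho> k n \<le> rn n" "rn n < 1" using rn rng(2)[of n] by (auto intro: le_less_trans)
      from log_mvt[OF True this] show ?thesis by blast
    qed auto
  qed
  then obtain z where z: "\<And>n. \<rho> k n > 0 \<longrightarrow> z n \<in> {\<rho> k n..rn n} \<and>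
      u n (\<rho> k n) - u n (rn n) = V n (z n) * (ln (rn n) - ln (\<rho> k n))"
    by metis
  let ?C = "(2 + a k) / G k"
  have C: "?C > 0" using a_pos[of k] G_pos[of k] by simp
  have Vz: "(\<lambda>n. g' (mu n) * V n (z n)) \<longlonglongrightarrow> ?C"
  proof (rule tendsto_sandwich[OF _ _ V_\<rho>(1)[OF k] V_\<rho>(2)[OF k]])
    show "\<forall>\<^sub>F n in sequentially. g' (mu n) * V n (\<rho> k n) \<le> g' (mu n) * V n (z n)"
      using \<rho>pos w_mu_pos
    proof eventually_elim
      case (elim n)
      have "V n (\<rho> k n) \<le> V n (z n)"
        using z[of n] elim rn[rule_format, of n] rng[of n] by (intro V_mono) auto
      thus ?case using elim by (intro mult_left_mono) auto
    qed
    show "\<forall>\<^sub>F n in sequentially. g' (mu n) * V n (z n) \<le> g' (mu n) * V n (\<sigma> (Suc k) n)"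
      using \<rho>pos w_mu_pos
    proof eventually_elim
      case (elim n)
      have "V n (z n) \<le> V n (\<sigma> (Suc k) n)"
        using z[of n] elim rn[rule_format, of n] rng[of n] by (intro V_mono) auto
      thus ?case using elim by (intro mult_left_mono) auto
    qed
  qed
  \<comment> \<open>Since \<open>w (mu n) * g' (mu n) = g (mu n)\<close>, dividing the difference of
    levels by the scaled flux leaves the logarithmic distance in units of
    \<open>g (mu n)\<close>.\<close>
  have "(\<lambda>n. ((mu n - u n (rn n)) / w (mu n) - (mu n - u n (\<rho> k n)) / w (mu n)) / (g' (mu n) * V n (z n)))
      \<longlonglongrightarrow> (x - c k) / ?C"
    using C by (intro tendsto_intros Vz lev[unfolded level_def] level_\<rho>[OF k, unfolded level_def]) auto
  moreover have "\<forall>\<^sub>F n in sequentially. g' (mu n) * V n (z n) \<noteq> 0"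
    using Vz C by (intro tendsto_imp_eventually_ne[of _ ?C]) auto
  hence "\<forall>\<^sub>F n in sequentially.
      ((mu n - u n (rn n)) / w (mu n) - (mu n - u n (\<rho> k n)) / w (mu n)) / (g' (mu n) * V n (z n))
      = (ln (rn n) - ln (\<rho> k n)) / g (mu n)"
    using \<rho>pos w_mu_pos
  proof eventually_elim
    case (elim n)
    have "(mu n - u n (rn n)) / w (mu n) - (mu n - u n (\<rho> k n)) / w (mu n)
        = V n (z n) * (ln (rn n) - ln (\<rho> k n)) / w (mu n)"
      using z[of n] elim by (simp add: diff_divide_distrib[symmetric])
    thus ?case using elim by (simp add: w_def field_simps)
  qed
  ultimately have ratio: "(\<lambda>n. (ln (rn n) - ln (\<rho> k n)) / g (mu n)) \<longlonglongrightarrow> (x - c k) / ?C"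
    by (rule Lim_transform_eventually)
  \<comment> \<open>\<open>\<rho> k n\<close> also belongs to region \<open>k\<close>, where
    \<open>region_scale\<close> supplies the initial value \<open>\<eta> k / 2\<close>.\<close>
  have "\<forall>\<^sub>F n in sequentially. \<rho> k n \<in> {\<sigma> k n..\<rho> k n} \<and> \<rho> k n > 0"
    using \<sigma>_less_\<rho>[OF k] by eventually_elim auto
  from region_scale[OF k this scaled_by_r[OF k ln_\<rho>_\<gamma>[OF k]]]
  have "(\<lambda>n. ln (1 / (sqrt (lam n) * \<rho> k n)) / g (mu n) - (ln (rn n) - ln (\<rho> k n)) / g (mu n))
      \<longlonglongrightarrow> \<eta> k / 2 - (x - c k) / ?C"
    by (rule tendsto_diff[OF _ ratio])
  moreover have "\<forall>\<^sub>F n in sequentially.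
      ln (1 / (sqrt (lam n) * \<rho> k n)) / g (mu n) - (ln (rn n) - ln (\<rho> k n)) / g (mu n)
      = ln (1 / (sqrt (lam n) * rn n)) / g (mu n)"
    using \<rho>pos
  proof eventually_elim
    case (elim n)
    hence "rn n > 0" using rn[rule_format, of n] by auto
    thus ?case using elim by (simp add: ln_scaled diff_divide_distrib[symmetric])
  qed
  ultimately show "(\<lambda>n. ln (1 / (sqrt (lam n) * rn n)) / g (mu n))
      \<longlonglongrightarrow> \<eta> k / 2 - (x - c k) * G k / (2 + a k)"
    by (simp add: Lim_transform_eventually)
qed

text \<open>\<open>gap_scale\<close> at level \<open>P * (1 - d)\<close> gives the denominator of
  \<open>alpha_super\<close>, and regular variation gives its numerator.\<close>

lemma gap_super:
  assumes q: "q > 1" and k: "k \<ge> 1" and d: "d \<in> {d_super P (Suc k)..d_super P k}"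
    and rn: "\<forall>n. rn n \<in> {\<rho> k n..\<sigma> (Suc k) n}" and lim: "(\<lambda>n. u n (rn n) / mu n) \<longlonglongrightarrow> d"
  shows "eq_coeff (\<lambda>n. g (u n (rn n))) (alpha_super P k d) (\<lambda>n. ln (1 / (sqrt (lam n) * rn n)))"
    and "eq_coeff (\<lambda>n. g (u n (rn n))) (alpha_super P k d) (\<lambda>n. ln (1 / rn n))"
proof -
  have P: "P > 2" using P_conjugate(2)[OF q] .
  define dk where "dk = d_super P k"
  define B where "B = 1 - 2 * P / (2 + a_super P k) * (1 - d / dk)"
  have B: "B > 0" unfolding B_def dk_def by (rule alpha_super_range(1)[OF P k d])
  have dk: "dk > 0" and ak: "a_super P k > 0" and "d > 0"
    using super_bounds[OF P, of k] super_bounds[OF P, of "Suc k"] d by (auto simp: dk_def)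
  have lev: "level (P * (1 - d)) rn"
    unfolding level_def using super_level[OF q lim] .
  have "\<eta> k / 2 - (P * (1 - d) - c k) * G k / (2 + a k) = dk powr P / 2 * B"
  proof -
    \<comment> \<open>As \<open>\<eta> k = dk * G k\<close>, the power
      \<open>dk powr (P - 1)\<close> is a common factor; \<open>**\<close> treats it as an arbitrary
      \<open>X\<close>, which makes the identity rational.\<close>
    have *: "dk powr P = dk * dk powr (P - 1)" using dk by (simp add: powr_diff)
    have **: "dk * X / 2 - (P * (1 - d) - P * (1 - dk)) * X / (2 + A)
        = dk * X / 2 * (1 - 2 * P / (2 + A) * (1 - d / dk))" if "A > 0" for A X
    proof -
      define L where "L = 2 + A"
      have "L > 0" using that by (simp add: L_def)
      hence "dk * X / 2 * (1 - 2 * P / L * y) = dk * X / 2 - P * X / L * (dk * y)" for y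
        by (simp add: field_simps)
      hence "dk * X / 2 * (1 - 2 * P / L * (1 - d / dk)) = dk * X / 2 - P * X / L * (dk * (1 - d / dk))" .
      also have "dk * (1 - d / dk) = dk - d" using dk by (simp add: algebra_simps)
      finally show ?thesis using dk \<open>L > 0\<close> unfolding L_def[symmetric] by (simp add: field_simps)
    qed
    show ?thesis
      unfolding B_def super_values[OF q] dk_def[symmetric] * by (rule **[OF ak])
  qed
  note Y = gap_scale(1)[OF k rn lev, unfolded this]
  have X: "(\<lambda>n. g (u n (rn n)) / g (mu n)) \<longlonglongrightarrow> d powr P"
    using regular_variation(2)[OF q P_conjugate(1)[OF q] mu_top lim \<open>d > 0\<close>] .
  have nz: "\<forall>\<^sub>F n in sequentially. g (mu n) \<noteq> 0"
    using w_mu_pos by eventually_elim auto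
  have \<alpha>: "alpha_super P k d = d powr P / (dk powr P / 2 * B)"
    using dk \<open>d > 0\<close> B unfolding alpha_super_def dk_def[symmetric] B_def[symmetric]
    by (simp add: powr_divide)
  have B0: "dk powr P / 2 * B \<noteq> 0" using B dk by simp
  show "eq_coeff (\<lambda>n. g (u n (rn n))) (alpha_super P k d) (\<lambda>n. ln (1 / (sqrt (lam n) * rn n)))"
    by (rule eq_coeffI[OF X Y B0 nz \<alpha>])
  have "(\<lambda>n. ln (1 / rn n) / g (mu n)) \<longlonglongrightarrow> dk powr P / 2 * B"
    by (rule drop_lam[OF _ gap_scale(2)[OF k rn lev] Y]) (simp add: q)
  thus "eq_coeff (\<lambda>n. g (u n (rn n))) (alpha_super P k d) (\<lambda>n. ln (1 / rn n))"
    by (rule eq_coeffI[OF X _ B0 nz \<alpha>])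
qed

lemma gap_crit:
  assumes q: "q = 1" and k: "k \<ge> 1" and e: "e \<in> {e_crit (Suc k)..e_crit k}"
    and rn: "\<forall>n. rn n \<in> {\<rho> k n..\<sigma> (Suc k) n}"
    and lim: "eq_coeff (\<lambda>n. mu n - u n (rn n)) (ln (1 / e)) (\<lambda>n. g (mu n) / g' (mu n))"
  shows "eq_coeff (\<lambda>n. g (u n (rn n))) (alpha_crit k e) (\<lambda>n. ln (1 / (sqrt (lam n) * rn n)))"
    and "inf_quot_pos f \<Longrightarrow> eq_coeff (\<lambda>n. g (u n (rn n))) (alpha_crit k e) (\<lambda>n. ln (1 / rn n))"
proof -
  define ek where "ek = e_crit k"
  define B where "B = 1 - 2 / (2 + a_crit k) * ln (ek / e)"
  have B: "B > 0" unfolding B_def ek_def by (rule alpha_crit_range(1)[OF k e])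
  have ek: "ek > 0" and ak: "a_crit k > 0" and "e > 0"
    using crit_bounds[of k] crit_bounds[of "Suc k"] e by (auto simp: ek_def)
  have lev: "level (ln (1 / e)) rn"
    unfolding level_def using crit_level[OF lim] .
  \<comment> \<open>Here \<open>\<eta> k\<close> and \<open>G k\<close> both equal
    \<open>ek\<close>, and \<open>ln (1 / e) - c k = ln (ek / e)\<close>, so \<open>ek / 2\<close>
    factors out.\<close>
  have "\<eta> k / 2 - (ln (1 / e) - c k) * G k / (2 + a k) = ek / 2 * B"
    unfolding B_def crit_values[OF q] ek_def[symmetric] using ek ak \<open>e > 0\<close>
    by (simp add: ln_div field_simps)
  note Y = gap_scale(1)[OF k rn lev, unfolded this]
  have "exp (- ln (1 / e)) = e" using \<open>e > 0\<close> by (simp add: ln_div)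
  with gamma_variation(2)[OF q mu_top lev[unfolded level_def]]
  have X: "(\<lambda>n. g (u n (rn n)) / g (mu n)) \<longlonglongrightarrow> e" by simp
  have nz: "\<forall>\<^sub>F n in sequentially. g (mu n) \<noteq> 0"
    using w_mu_pos by eventually_elim auto
  have \<alpha>: "alpha_crit k e = e / (ek / 2 * B)"
    unfolding alpha_crit_def B_def ek_def by simp
  have B0: "ek / 2 * B \<noteq> 0" using B ek by simp
  show "eq_coeff (\<lambda>n. g (u n (rn n))) (alpha_crit k e) (\<lambda>n. ln (1 / (sqrt (lam n) * rn n)))"
    by (rule eq_coeffI[OF X Y B0 nz \<alpha>])
  assume inf: "inf_quot_pos f"
  have "(\<lambda>n. ln (1 / rn n) / g (mu n)) \<longlonglongrightarrow> ek / 2 * B"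
    by (rule drop_lam[OF _ gap_scale(2)[OF k rn lev] Y]) (simp add: q inf)
  thus "eq_coeff (\<lambda>n. g (u n (rn n))) (alpha_crit k e) (\<lambda>n. ln (1 / rn n))"
    by (rule eq_coeffI[OF X _ B0 nz \<alpha>])
qed

end

section \<open>Assembly of the three claims along the subsequence\<close>

theorem theorem2p1:
  fixes h f :: "real \<Rightarrow> real" and t0 q :: real and p :: ereal
    and lam0 mu0 :: "nat \<Rightarrow> real" and u0 :: "nat \<Rightarrow> real \<Rightarrow> real"
    and \<phi> :: "nat \<Rightarrow> nat"
    and r \<gamma> \<rho> \<sigma> :: "nat \<Rightarrow> nat \<Rightarrow> real"
  assumes "nonlinearity h f t0"
    and "gen_exp_growth f t0 q p"
    and "solution_seq h f lam0 mu0 u0"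
    and "filterlim mu0 at_top sequentially"
    and "strict_mono \<phi>"
    and "concentration_seqs h f t0 q (real_of_ereal p)
           (lam0 \<circ> \<phi>) (mu0 \<circ> \<phi>) (u0 \<circ> \<phi>) r \<gamma> \<rho> \<sigma>"
  shows
    "let lam = lam0 \<circ> \<phi>; mu = mu0 \<circ> \<phi>; u = u0 \<circ> \<phi>;
         g = log_f f; g' = deriv_on {t0..} g; P = real_of_ereal p;
         a = a_seq q P; b = b_seq q P; \<delta> = delta_seq q P; \<eta> = eta_seq q P
     in
      (1 \<le> q \<and> q < 2 \<longrightarrow>
        (\<forall>k\<ge>1. \<forall>rn R.
          (\<forall>n. rn n \<in> {\<sigma> k n..\<rho> k n} \<and> rn n > 0 \<and> R n = rn n / \<gamma> k n) \<longrightarrow>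
            (\<lambda>n. g (u n (rn n)) + ln (g' (u n (rn n)))
                 - (2 * ln (1 / (sqrt (lam n) * rn n))
                    + ln (2 * (a k)\<^sup>2 * b k * R n powr a k
                          / (h 0 * (1 + b k * R n powr a k)\<^sup>2)))) \<longlonglongrightarrow> 0 \<and>
            ((k = 1 \<longrightarrow> (\<lambda>n. ln (R n) / g (mu n)) \<longlonglongrightarrow> 0) \<and> (q = 1 \<longrightarrow> inf_quot_pos f) \<longrightarrow>
               eq_coeff (\<lambda>n. g (u n (rn n))) 2 (\<lambda>n. ln (1 / rn n)))))
    \<and> (1 < q \<and> q < 2 \<longrightarrow>
        (\<forall>k\<ge>1.
          (\<forall>x\<in>{\<delta> (Suc k)..\<delta> k}. alpha_super P k x \<in> {0<..2}) \<and>
          (\<forall>rn. \<forall>d\<in>{\<delta> (Suc k)..\<delta> k}.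
             (\<forall>n. rn n \<in> {\<rho> k n..\<sigma> (Suc k) n}) \<and> (\<lambda>n. u n (rn n) / mu n) \<longlonglongrightarrow> d \<longrightarrow>
               eq_coeff (\<lambda>n. g (u n (rn n))) (alpha_super P k d)
                 (\<lambda>n. ln (1 / (sqrt (lam n) * rn n))) \<and>
               eq_coeff (\<lambda>n. g (u n (rn n))) (alpha_super P k d) (\<lambda>n. ln (1 / rn n)))))
    \<and> (q = 1 \<longrightarrow>
        (\<forall>k\<ge>1.
          (\<forall>x\<in>{\<eta> (Suc k)..\<eta> k}. alpha_crit k x \<in> {0<..2}) \<and>
          (\<forall>rn. \<forall>e\<in>{\<eta> (Suc k)..\<eta> k}.
             (\<forall>n. rn n \<in> {\<rho> k n..\<sigma> (Suc k) n}) \<and>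
             eq_coeff (\<lambda>n. mu n - u n (rn n)) (ln (1 / e)) (\<lambda>n. g (mu n) / g' (mu n)) \<longrightarrow>
               eq_coeff (\<lambda>n. g (u n (rn n))) (alpha_crit k e)
                 (\<lambda>n. ln (1 / (sqrt (lam n) * rn n))) \<and>
               (inf_quot_pos f \<longrightarrow>
                 eq_coeff (\<lambda>n. g (u n (rn n))) (alpha_crit k e) (\<lambda>n. ln (1 / rn n))))))"
proof -
  define lam mu u where defs: "lam = lam0 \<circ> \<phi>" "mu = mu0 \<circ> \<phi>" "u = u0 \<circ> \<phi>"
  have sol: "solution_seq h f lam mu u"
    using assms(3) unfolding defs solution_seq_def Let_def by simp
  have mu: "filterlim mu at_top sequentially"
    unfolding defs comp_def using filterlim_compose[OF assms(4) filterlim_subseq[OF assms(5)]] .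
  have conc: "concentration h f t0 q p lam mu u r \<gamma> \<rho> \<sigma>" if "1 \<le> q" "q < 2"
    using that assms(1,2,6) sol mu unfolding defs by (intro concentration.intro)
  show ?thesis
    unfolding Let_def defs[symmetric]
  proof (intro conjI impI allI ballI; (elim conjE)?)
    fix k :: nat and rn R :: "nat \<Rightarrow> real"
    assume q: "1 \<le> q" "q < 2" and k: "1 \<le> k"
      and R: "\<forall>n. rn n \<in> {\<sigma> k n..\<rho> k n} \<and> 0 < rn n \<and> R n = rn n / \<gamma> k n"
    interpret concentration h f t0 q p lam mu u r \<gamma> \<rho> \<sigma> by (rule conc[OF q])
    have RR: "R n = rn n / \<gamma> k n" "rn n > 0" "R n > 0" for n
      using R \<gamma>_pos[OF k, of n] by auto
    \<comment> \<open>The claim keeps \<open>h 0\<close> inside the logarithm; positivity of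
      \<open>Q\<close> and \<open>h 0\<close> allows splitting it off.\<close>
    have ln_eq: "ln (2 * (a k)\<^sup>2 * b k * R n powr a k / (h 0 * (1 + b k * R n powr a k)\<^sup>2))
        = ln (Q k (rn n / \<gamma> k n)) - ln (h 0)" for n
    proof -
      have "2 * (a k)\<^sup>2 * b k * R n powr a k / (h 0 * (1 + b k * R n powr a k)\<^sup>2) = Q k (R n) / h 0"
        by (simp add: Q_def)
      thus ?thesis
        using Q_pos[OF RR(3), of k n] h_facts(1) by (simp add: ln_divide_pos RR(1))
    qed
    show "(\<lambda>n. g (u n (rn n)) + ln (g' (u n (rn n)))
        - (2 * ln (1 / (sqrt (lam n) * rn n))
          + ln (2 * (a k)\<^sup>2 * b k * R n powr a k / (h 0 * (1 + b k * R n powr a k)\<^sup>2)))) \<longlonglongrightarrow> 0"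
      unfolding ln_eq using R by (intro region_asymptotics k) simp
    show "eq_coeff (\<lambda>n. g (u n (rn n))) 2 (\<lambda>n. ln (1 / rn n))"
      if "k = 1 \<longrightarrow> (\<lambda>n. ln (R n) / g (mu n)) \<longlonglongrightarrow> 0" "q = 1 \<longrightarrow> inf_quot_pos f"
      using R that by (intro region_eq_coeff[OF k]) (simp_all add: RR(1))
  next
    fix k :: nat and x
    assume q: "1 < q" "q < 2" and k: "1 \<le> k"
      and x: "x \<in> {delta_seq q (real_of_ereal p) (Suc k)..delta_seq q (real_of_ereal p) k}"
    interpret concentration h f t0 q p lam mu u r \<gamma> \<rho> \<sigma> by (rule conc) (use q in auto)
    show "alpha_super P k x \<in> {0<..2}"
      using x q(1) by (intro alpha_super_range P_conjugate k) (simp_all add: delta_seq_def)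
    fix rn
    assume rn: "\<forall>n. rn n \<in> {\<rho> k n..\<sigma> (Suc k) n}" and lim: "(\<lambda>n. u n (rn n) / mu n) \<longlonglongrightarrow> x"
    have x': "x \<in> {d_super P (Suc k)..d_super P k}" using x q(1) by (simp add: delta_seq_def)
    show "eq_coeff (\<lambda>n. g (u n (rn n))) (alpha_super P k x) (\<lambda>n. ln (1 / (sqrt (lam n) * rn n)))"
      "eq_coeff (\<lambda>n. g (u n (rn n))) (alpha_super P k x) (\<lambda>n. ln (1 / rn n))"
      by (rule gap_super[OF q(1) k x' rn lim])+
  next
    fix k :: nat and x
    assume q: "q = 1" and k: "1 \<le> k"
      and x: "x \<in> {eta_seq q (real_of_ereal p) (Suc k)..eta_seq q (real_of_ereal p) k}"
    interpret concentration h f t0 q p lam mu u r \<gamma> \<rho> \<sigma> by (rule conc) (use q in auto)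
    have x': "x \<in> {e_crit (Suc k)..e_crit k}" using x q by (simp add: eta_seq_def)
    show "alpha_crit k x \<in> {0<..2}" by (rule alpha_crit_range(2)[OF k x'])
    fix rn
    assume rn: "\<forall>n. rn n \<in> {\<rho> k n..\<sigma> (Suc k) n}"
      and lim: "eq_coeff (\<lambda>n. mu n - u n (rn n)) (ln (1 / x)) (\<lambda>n. g (mu n) / g' (mu n))"
    show "eq_coeff (\<lambda>n. g (u n (rn n))) (alpha_crit k x) (\<lambda>n. ln (1 / (sqrt (lam n) * rn n)))"
      by (rule gap_crit(1)[OF q k x' rn lim])
    show "eq_coeff (\<lambda>n. g (u n (rn n))) (alpha_crit k x) (\<lambda>n. ln (1 / rn n))" if "inf_quot_pos f"
      by (rule gap_crit(2)[OF q k x' rn lim that])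
  qed
qed

end
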